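(* Let $1<p<\infty$, let $C_p$ be the constant in the generalized Poincaré inequality $$\int_0^1|v(t)|^p\,dt\le C_p\int_0^1|\dot v(t)|^p\,dt,$$ valid for all absolutely continuous $v$ on $[0,1]$ with $\dot v\in L_p[0,1]$ and $v(0)=v(1)=0$. Let $\Omega\subset\mathbb{R}^2$ be a convex compact domain both of whose vertical lines of support are angular. (1) If the extreme left and extreme right points of $\Omega$ are $(0,0)$ and $(2,0)$ respectively, then $$K_p(\Omega)\ \le\ M_p(\Omega):=m\left(2\,(C_p)^{1/p}+1\right),$$ where $m$ is the largest modulus of the four slopes of the tangents to $\Omega$ at the points $(0,0)$ and $(2,0)$. (2) In general, $$K_p(\Omega)\ \le\ \frac{2}{w_x}\,M_p(\tilde\Omega)+\frac{|c|}{w_x},$$ where $w_x$ is the length of the projection of $\Omega$ to the $x$-axis, $c$ is the $y$-coordinate of the extreme right point minus the $y$-coordinate of the extreme left point $(x_0,y_0)$ of $\Omega$, and $\tilde\Omega$ is the domain, with extreme left point $(0,0)$ and extreme right point $(2,0)$, consisting of the points $(\tilde x,\tilde y)$ such that $(x,y)\in\Omega$, where $$x=x_0+\frac{w_x}{2}\tilde x,\qquad y=y_0+\frac{c}{2}\tilde x+\tilde y .$$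
   Context: A convex compact domain is a compact convex set $\Omega\subset\mathbb{R}^2$ with nonempty interior. $\mathcal{U}_\Omega$ denotes the class of continuous concave functions $u:\Omega\to\mathbb{R}$ with $u|_{\partial\Omega}=0$ whose gradient $\nabla u=(u_x,u_y)$ is uniformly bounded over all interior points of $\Omega$ at which it is defined (it is defined almost everywhere). $\|f\|_p=\left(\int_\Omega|f|^p\,dx\,dy\right)^{1/p}$ and $K_p(\Omega)=\sup_{u\in\mathcal{U}_\Omega,\,u\ne0}\|u_x\|_p/\|u_y\|_p$. The tangent cone to $\Omega$ with vertex at $\xi\in\partial\Omega$ is the intersection of all closed half-planes containing $\Omega$ and bounded by lines of support of $\Omega$ through $\xi$. A point $\xi\in\partial\Omega$ is singular if there is more than one line of support to $\Omega$ through $\xi$. A line is called an angular support line if, for some singular point $\xi\in\partial\Omega$, it intersects the tangent cone with vertex $\xi$ exactly in $\xi$. If both vertical support lines are angular, $\Omega$ has a unique extreme left point and a unique extreme right point (the left and right angular points). If $\Omega$ (with extreme left and right points $(0,0)$, $(2,0)$) is written as $\{(x,y): 0\le x\le 2,\ \varphi_1(x)\le y\le\varphi_2(x)\}$ with $\varphi_1$ convex and $\varphi_2$ concave, the four slopes are the one-sided derivatives $\varphi_1'(0),\varphi_2'(0),\varphi_1'(2),\varphi_2'(2)$. *)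

theory Defs
  imports "HOL-Analysis.Analysis"
begin

section \<open>Support lines and angular points\<close>

definition convex_compact_domain :: "(real \<times> real) set \<Rightarrow> bool" where
  "convex_compact_domain \<Omega> \<longleftrightarrow> compact \<Omega> \<and> convex \<Omega> \<and> interior \<Omega> \<noteq> {}"

definition is_line :: "(real \<times> real) set \<Rightarrow> bool" where
  "is_line L \<longleftrightarrow> (\<exists>n b. n \<noteq> 0 \<and> L = {z. n \<bullet> z = b})"

definition support_line :: "(real \<times> real) set \<Rightarrow> (real \<times> real) set \<Rightarrow> bool" where
  "support_line \<Omega> L \<longleftrightarrow>
     (\<exists>n b. n \<noteq> 0 \<and> L = {z. n \<bullet> z = b} \<and> \<Omega> \<subseteq> {z. n \<bullet> z \<le> b} \<and> L \<inter> \<Omega> \<noteq> {})"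

definition tangent_cone :: "(real \<times> real) set \<Rightarrow> real \<times> real \<Rightarrow> (real \<times> real) set" where
  "tangent_cone \<Omega> \<xi> =
     \<Inter> {{z. n \<bullet> z \<le> b} | n b. n \<noteq> 0 \<and> \<Omega> \<subseteq> {z. n \<bullet> z \<le> b} \<and>
          support_line \<Omega> {z. n \<bullet> z = b} \<and> \<xi> \<in> {z. n \<bullet> z = b}}"

definition singular_point :: "(real \<times> real) set \<Rightarrow> real \<times> real \<Rightarrow> bool" where
  "singular_point \<Omega> \<xi> \<longleftrightarrow> \<xi> \<in> frontier \<Omega> \<and>
     (\<exists>L1 L2. support_line \<Omega> L1 \<and> support_line \<Omega> L2 \<and> \<xi> \<in> L1 \<and> \<xi> \<in> L2 \<and> L1 \<noteq> L2)"

definition angular_support_line :: "(real \<times> real) set \<Rightarrow> (real \<times> real) set \<Rightarrow> bool" where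
  "angular_support_line \<Omega> L \<longleftrightarrow>
     is_line L \<and> (\<exists>\<xi>. singular_point \<Omega> \<xi> \<and> L \<inter> tangent_cone \<Omega> \<xi> = {\<xi>})"

definition vertical_line :: "real \<Rightarrow> (real \<times> real) set" where
  "vertical_line a = {z. fst z = a}"

definition both_vertical_support_lines_angular :: "(real \<times> real) set \<Rightarrow> bool" where
  "both_vertical_support_lines_angular \<Omega> \<longleftrightarrow>
     (\<forall>a. support_line \<Omega> (vertical_line a) \<longrightarrow> angular_support_line \<Omega> (vertical_line a))"

text \<open>
  The extreme left and right points exist and are unique when both vertical support lines are
  angular; otherwise the descriptions below may be unspecified.
\<close>

definition left_point :: "(real \<times> real) set \<Rightarrow> real \<times> real" where
  "left_point \<Omega> = (THE z. z \<in> \<Omega> \<and> (\<forall>w\<in>\<Omega>. fst z \<le> fst w))"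

definition right_point :: "(real \<times> real) set \<Rightarrow> real \<times> real" where
  "right_point \<Omega> = (THE z. z \<in> \<Omega> \<and> (\<forall>w\<in>\<Omega>. fst w \<le> fst z))"

definition x_width :: "(real \<times> real) set \<Rightarrow> real" where
  "x_width \<Omega> = measure lborel (fst ` \<Omega>)"


section \<open>The class of admissible functions and the constant $K_p$\<close>

definition partial_x :: "(real \<times> real \<Rightarrow> real) \<Rightarrow> real \<times> real \<Rightarrow> real" where
  "partial_x u z = deriv (\<lambda>t. u (t, snd z)) (fst z)"

definition partial_y :: "(real \<times> real \<Rightarrow> real) \<Rightarrow> real \<times> real \<Rightarrow> real" where
  "partial_y u z = deriv (\<lambda>t. u (fst z, t)) (snd z)"

definition gradient_defined :: "(real \<times> real \<Rightarrow> real) \<Rightarrow> real \<times> real \<Rightarrow> bool" where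
  "gradient_defined u z \<longleftrightarrow>
     (\<lambda>t. u (t, snd z)) differentiable (at (fst z)) \<and>
     (\<lambda>t. u (fst z, t)) differentiable (at (snd z))"

definition admissible :: "(real \<times> real) set \<Rightarrow> (real \<times> real \<Rightarrow> real) set" where
  "admissible \<Omega> = {u. continuous_on \<Omega> u \<and> concave_on \<Omega> u \<and> (\<forall>z\<in>frontier \<Omega>. u z = 0) \<and>
     (\<exists>B. \<forall>z\<in>interior \<Omega>. gradient_defined u z \<longrightarrow> norm (partial_x u z, partial_y u z) \<le> B)}"

text \<open>
  The integral is taken with respect to the completed Lebesgue measure, so the unspecified values of
  the partial derivatives on the null set where they do not exist (including the boundary, where
  they would depend on values outside the domain) are irrelevant.
\<close>

definition Lp_norm :: "real \<Rightarrow> (real \<times> real) set \<Rightarrow> (real \<times> real \<Rightarrow> real) \<Rightarrow> real" where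
  "Lp_norm p \<Omega> f = (LINT z:\<Omega>|lebesgue. \<bar>f z\<bar> powr p) powr (1 / p)"

definition K_const :: "real \<Rightarrow> (real \<times> real) set \<Rightarrow> ereal" where
  "K_const p \<Omega> = (SUP u \<in> {u \<in> admissible \<Omega>. \<exists>z\<in>\<Omega>. u z \<noteq> 0}.
     ereal (Lp_norm p \<Omega> (partial_x u) / Lp_norm p \<Omega> (partial_y u)))"


section \<open>The generalized Poincare inequality\<close>

definition abs_continuous_on :: "real \<Rightarrow> real \<Rightarrow> (real \<Rightarrow> real) \<Rightarrow> bool" where
  "abs_continuous_on a b v \<longleftrightarrow>
     (\<forall>\<epsilon>>0. \<exists>\<delta>>0. \<forall>D :: (real \<times> real) set.
        finite D \<and> (\<forall>(s, t)\<in>D. a \<le> s \<and> s < t \<and> t \<le> b) \<and>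
        pairwise (\<lambda>(s, t) (s', t'). {s<..<t} \<inter> {s'<..<t'} = {}) D \<and>
        (\<Sum>(s, t)\<in>D. t - s) < \<delta> \<longrightarrow>
        (\<Sum>(s, t)\<in>D. \<bar>v t - v s\<bar>) < \<epsilon>)"

text \<open>
  An absolutely continuous function is differentiable almost everywhere, so \<open>deriv v\<close> is its
  derivative up to a null set and is measurable.
\<close>

definition poincare_constant :: "real \<Rightarrow> real \<Rightarrow> bool" where
  "poincare_constant p C \<longleftrightarrow>
     (\<forall>v. abs_continuous_on 0 1 v \<and>
          set_integrable lebesgue {0..1} (\<lambda>t. \<bar>deriv v t\<bar> powr p) \<and> v 0 = 0 \<and> v 1 = 0 \<longrightarrow>
          (LINT t:{0..1}|lebesgue. \<bar>v t\<bar> powr p)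
            \<le> C * (LINT t:{0..1}|lebesgue. \<bar>deriv v t\<bar> powr p))"


section \<open>Slopes, the bound $M_p$ and the normalized domain\<close>

definition lower_graph :: "(real \<times> real) set \<Rightarrow> real \<Rightarrow> real" where
  "lower_graph \<Omega> x = Inf {y. (x, y) \<in> \<Omega>}"

definition upper_graph :: "(real \<times> real) set \<Rightarrow> real \<Rightarrow> real" where
  "upper_graph \<Omega> x = Sup {y. (x, y) \<in> \<Omega>}"

text \<open>
  The derivatives within \<open>{0..2}\<close> at its endpoints are the one-sided derivatives. The two
  definitions below are meant for domains with extreme points \<open>(0, 0)\<close> and \<open>(2, 0)\<close>.
\<close>

definition max_slope :: "(real \<times> real) set \<Rightarrow> real" where
  "max_slope \<Omega> = Max
     {\<bar>vector_derivative (lower_graph \<Omega>) (at 0 within {0..2})\<bar>,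
      \<bar>vector_derivative (upper_graph \<Omega>) (at 0 within {0..2})\<bar>,
      \<bar>vector_derivative (lower_graph \<Omega>) (at 2 within {0..2})\<bar>,
      \<bar>vector_derivative (upper_graph \<Omega>) (at 2 within {0..2})\<bar>}"

definition M_bound :: "real \<Rightarrow> real \<Rightarrow> (real \<times> real) set \<Rightarrow> real" where
  "M_bound p C \<Omega> = max_slope \<Omega> * (2 * C powr (1 / p) + 1)"

definition y_shift :: "(real \<times> real) set \<Rightarrow> real" where
  "y_shift \<Omega> = snd (right_point \<Omega>) - snd (left_point \<Omega>)"

definition normalized_domain :: "(real \<times> real) set \<Rightarrow> (real \<times> real) set" where
  "normalized_domain \<Omega> =
     {(x', y'). (fst (left_point \<Omega>) + x_width \<Omega> / 2 * x',
                 snd (left_point \<Omega>) + y_shift \<Omega> / 2 * x' + y') \<in> \<Omega>}"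

end

theory Submission
  imports Defs
begin

text \<open>
  The estimate comes from comparing \<open>u\<close> with its tangent planes at interior points. A concave
  function lies below each of them, and \<open>u\<close> vanishes at the extreme left point \<open>P\<close> and at the
  extreme right point \<open>Q\<close>. Evaluating the tangent plane at \<open>z\<close> in these two points bounds the
  derivative of \<open>u\<close> along the chord \<open>PQ\<close> from both sides. With \<open>k\<close> the slope of the chord, \<open>d\<close> the
  smaller of the horizontal distances from \<open>z\<close> to \<open>P\<close> and to \<open>Q\<close>, and \<open>y\<close> the height of \<open>z\<close> above
  the chord, the result is \<open>\<bar>u_x + k u_y\<bar> \<le> (\<bar>u\<bar> + \<bar>y\<bar> \<bar>u_y\<bar>) / d\<close> (\<open>partial_x_bound\<close>).

  If both vertical support lines are angular, \<open>\<Omega>\<close> lies in a double cone \<open>\<bar>y\<bar> \<le> \<mu> d\<close>. Hence the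
  term with \<open>\<bar>y\<bar>\<close> is at most \<open>\<mu> \<bar>u_y\<bar>\<close>, and every vertical slice of \<open>\<Omega>\<close> has length at most
  \<open>2 \<mu> d\<close>. The generalized Poincare inequality, rescaled to such a slice and integrated over the
  horizontal variable, bounds the norm of \<open>u / d\<close> by \<open>2 \<mu> (C powr (1 / p))\<close> times the norm of \<open>u_y\<close>
  (\<open>weighted_poincare\<close>). By Minkowski's inequality the quotient of the norms of \<open>u_x\<close> and \<open>u_y\<close> is
  at most \<open>\<mu> (2 C powr (1 / p) + 1) + \<bar>k\<bar>\<close> (\<open>K_const_le\<close>).

  It remains to find a good \<open>\<mu>\<close>. The affine map from \<open>\<Omega>\<close> to the normalized domain sends \<open>P\<close> and
  \<open>Q\<close> to \<open>(0, 0)\<close> and \<open>(2, 0)\<close> and the height above the chord to the second coordinate. It shows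
  that \<open>\<mu> = 2 m / w\<close> works, where \<open>w\<close> is the width of \<open>\<Omega>\<close> and \<open>m\<close> the largest of the four slopes of
  the normalized domain: a concave function on an interval lies below its one-sided tangents at the
  endpoints (\<open>abs_snd_le_max_slope\<close>). So part (2) is proved directly on \<open>\<Omega>\<close>, and part (1) is the
  case in which \<open>\<Omega>\<close> is its own normalized domain.

  Two points need care. First, \<open>u\<close> has partial derivatives almost everywhere: a concave function
  of one variable has only countably many points of non-differentiability, and the set of bad points
  in the plane is Borel, because differentiability of a concave function is equivalent to the
  convergence to zero of a sequence of second differences. Second, the bound on the gradient makes
  \<open>u\<close> Lipschitz, so its restrictions to slices are absolutely continuous and the Poincare inequality
  applies to them.
\<close>


section \<open>Extreme points and the enclosing cone\<close>

text \<open>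
  Angularity says that the points directly above and below the vertex are cut off from the tangent
  cone, hence from \<open>\<Omega>\<close>, by non-vertical support lines. The slopes of one such line above and one
  below give \<open>\<kappa>\<close>. The cone makes the extreme point unique and the slopes of the boundary at it
  finite.
\<close>
lemma angular_support_line_cone:
  assumes "support_line \<Omega> (vertical_line a)" "angular_support_line \<Omega> (vertical_line a)"
  obtains \<xi> \<kappa> where "\<xi> \<in> \<Omega>" "fst \<xi> = a" "0 \<le> \<kappa>"
    "\<And>z. z \<in> \<Omega> \<Longrightarrow> \<bar>snd z - snd \<xi>\<bar> \<le> \<kappa> * \<bar>fst z - a\<bar>"
proof -
  obtain \<xi> where \<xi>: "vertical_line a \<inter> tangent_cone \<Omega> \<xi> = {\<xi>}"
    using assms(2) by (auto simp: angular_support_line_def)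
  have sub: "\<Omega> \<subseteq> tangent_cone \<Omega> \<xi>"
    by (auto simp: tangent_cone_def)
  obtain z0 where "z0 \<in> \<Omega>" "fst z0 = a"
    using assms(1) by (auto simp: support_line_def vertical_line_def)
  with sub \<xi> have \<xi>\<Omega>: "\<xi> \<in> \<Omega>" and fst\<xi>: "fst \<xi> = a"
    by (auto simp: vertical_line_def)
  \<comment> \<open>The case s = 1 bounds the domain from above, the case s = -1 from below.\<close>
  have half: "\<exists>k\<ge>0. \<forall>z\<in>\<Omega>. s * (snd z - snd \<xi>) \<le> k * \<bar>fst z - a\<bar>" if s: "\<bar>s\<bar> = 1" for s :: real
  proof -
    have "\<xi> + (0, s) \<notin> tangent_cone \<Omega> \<xi>"
    proof
      assume "\<xi> + (0, s) \<in> tangent_cone \<Omega> \<xi>"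
      moreover have "\<xi> + (0, s) \<in> vertical_line a"
        using fst\<xi> by (simp add: vertical_line_def)
      ultimately have "\<xi> + (0, s) \<in> {\<xi>}"
        unfolding \<xi>[symmetric] by blast
      then show False using s by (auto simp: prod_eq_iff)
    qed
    then obtain n b where nb: "\<Omega> \<subseteq> {z. n \<bullet> z \<le> b}" "n \<bullet> \<xi> = b" "n \<bullet> (\<xi> + (0, s)) > b"
      unfolding tangent_cone_def by (smt (verit) Inter_iff mem_Collect_eq)
    obtain n1 n2 where n: "n = (n1, n2)" by fastforce
    have pos: "n2 * s > 0" using nb(2,3) by (simp add: n inner_add_right)
    have n2: "n2 = \<bar>n2\<bar> * s"
      using s pos by (auto simp: abs_if zero_less_mult_iff split: if_splits)
    have n20: "0 < \<bar>n2\<bar>" using pos by auto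
    show ?thesis
    proof (intro exI[of _ "\<bar>n1\<bar> / \<bar>n2\<bar>"] conjI ballI)
      fix z assume "z \<in> \<Omega>"
      then have "n \<bullet> z \<le> n \<bullet> \<xi>" using nb by auto
      then have "n2 * (snd z - snd \<xi>) \<le> - n1 * (fst z - a)"
        by (cases z; cases \<xi>) (use fst\<xi> in \<open>auto simp: n algebra_simps\<close>)
      also have "\<dots> \<le> \<bar>n1\<bar> * \<bar>fst z - a\<bar>"
        by (metis abs_ge_self abs_minus_cancel abs_mult)
      finally have "\<bar>n2\<bar> * (s * (snd z - snd \<xi>)) \<le> \<bar>n1\<bar> * \<bar>fst z - a\<bar>"
        using n2 by (metis mult.assoc)
      then show "s * (snd z - snd \<xi>) \<le> \<bar>n1\<bar> / \<bar>n2\<bar> * \<bar>fst z - a\<bar>"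
        using n20 by (simp add: pos_le_divide_eq mult.commute)
    qed auto
  qed
  obtain k1 k2 where k: "k1 \<ge> 0" "k2 \<ge> 0"
    "\<forall>z\<in>\<Omega>. snd z - snd \<xi> \<le> k1 * \<bar>fst z - a\<bar>"
    "\<forall>z\<in>\<Omega>. - (snd z - snd \<xi>) \<le> k2 * \<bar>fst z - a\<bar>"
    using half[of 1] half[of "-1"] by auto
  have "\<bar>snd z - snd \<xi>\<bar> \<le> max k1 k2 * \<bar>fst z - a\<bar>" if "z \<in> \<Omega>" for z
  proof -
    have "k1 * \<bar>fst z - a\<bar> \<le> max k1 k2 * \<bar>fst z - a\<bar>" "k2 * \<bar>fst z - a\<bar> \<le> max k1 k2 * \<bar>fst z - a\<bar>"
      by (auto intro!: mult_right_mono)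
    moreover have "snd z - snd \<xi> \<le> k1 * \<bar>fst z - a\<bar>" "- (snd z - snd \<xi>) \<le> k2 * \<bar>fst z - a\<bar>"
      using k(3,4) that by blast+
    ultimately show ?thesis by linarith
  qed
  with \<xi>\<Omega> fst\<xi> k(1) show ?thesis by (intro that[of \<xi> "max k1 k2"]) auto
qed

lemma angular_domain_extreme_points:
  assumes dom: "convex_compact_domain \<Omega>"
    and ang: "both_vertical_support_lines_angular \<Omega>"
  obtains P Q \<kappa> where "P \<in> \<Omega>" "Q \<in> \<Omega>" "left_point \<Omega> = P" "right_point \<Omega> = Q" "fst P < fst Q"
    "x_width \<Omega> = fst Q - fst P" "0 \<le> \<kappa>"
    "\<And>z. z \<in> \<Omega> \<Longrightarrow> fst P \<le> fst z \<and> fst z \<le> fst Q"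
    "\<And>z. z \<in> \<Omega> \<Longrightarrow> \<bar>snd z - snd P\<bar> \<le> \<kappa> * (fst z - fst P)"
    "\<And>z. z \<in> \<Omega> \<Longrightarrow> \<bar>snd z - snd Q\<bar> \<le> \<kappa> * (fst Q - fst z)"
proof -
  have cp: "compact \<Omega>" and cv: "convex \<Omega>" and int: "interior \<Omega> \<noteq> {}"
    using dom by (auto simp: convex_compact_domain_def)
  have ne: "\<Omega> \<noteq> {}" using int by auto
  have cont: "continuous_on \<Omega> fst" by (intro continuous_intros)
  obtain a where a: "a \<in> \<Omega>" "\<And>z. z \<in> \<Omega> \<Longrightarrow> fst a \<le> fst z"
    using continuous_attains_inf[OF cp ne cont] by blast
  obtain b where b: "b \<in> \<Omega>" "\<And>z. z \<in> \<Omega> \<Longrightarrow> fst z \<le> fst b"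
    using continuous_attains_sup[OF cp ne cont] by blast
  have sa: "support_line \<Omega> (vertical_line (fst a))"
    unfolding support_line_def
    by (intro exI[of _ "(-1,0)"] exI[of _ "- fst a"]) (use a in \<open>auto simp: vertical_line_def zero_prod_def\<close>)
  have sb: "support_line \<Omega> (vertical_line (fst b))"
    unfolding support_line_def
    by (intro exI[of _ "(1,0)"] exI[of _ "fst b"]) (use b in \<open>auto simp: vertical_line_def zero_prod_def\<close>)
  have "angular_support_line \<Omega> (vertical_line (fst a))"
    using ang sa by (auto simp: both_vertical_support_lines_angular_def)
  from angular_support_line_cone[OF sa this]
  obtain P k1 where P: "P \<in> \<Omega>" "fst P = fst a" "0 \<le> k1"
    and k1: "\<And>z. z \<in> \<Omega> \<Longrightarrow> \<bar>snd z - snd P\<bar> \<le> k1 * \<bar>fst z - fst a\<bar>" by blast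
  have "angular_support_line \<Omega> (vertical_line (fst b))"
    using ang sb by (auto simp: both_vertical_support_lines_angular_def)
  from angular_support_line_cone[OF sb this]
  obtain Q k2 where Q: "Q \<in> \<Omega>" "fst Q = fst b" "0 \<le> k2"
    and k2: "\<And>z. z \<in> \<Omega> \<Longrightarrow> \<bar>snd z - snd Q\<bar> \<le> k2 * \<bar>fst z - fst b\<bar>" by blast
  have bnd: "fst P \<le> fst z \<and> fst z \<le> fst Q" if "z \<in> \<Omega>" for z
    using a b P Q that by auto
  have PQ: "fst P < fst Q"
  proof (rule ccontr)
    assume "\<not> fst P < fst Q"
    then have eq: "fst z = fst P" if "z \<in> \<Omega>" for z using bnd[OF that] by linarith
    obtain z e where ze: "e > 0" "ball z e \<subseteq> \<Omega>" using int by (auto simp: mem_interior)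
    have "z \<in> ball z e" "z + (e/2, 0) \<in> ball z e"
      using ze(1) by (auto simp: dist_norm norm_Pair)
    then have "fst z = fst P" "fst (z + (e/2,0)) = fst P" using ze(2) eq by blast+
    then show False using ze(1) by auto
  qed
  have L: "left_point \<Omega> = P"
    unfolding left_point_def
  proof (rule the_equality)
    show "P \<in> \<Omega> \<and> (\<forall>w\<in>\<Omega>. fst P \<le> fst w)" using P bnd by auto
    fix z assume z: "z \<in> \<Omega> \<and> (\<forall>w\<in>\<Omega>. fst z \<le> fst w)"
    then have "fst z = fst a" using a P(1) by (simp add: order_antisym)
    with k1[of z] z P show "z = P" by (simp add: prod_eq_iff)
  qed
  have R: "right_point \<Omega> = Q"
    unfolding right_point_def
  proof (rule the_equality)
    show "Q \<in> \<Omega> \<and> (\<forall>w\<in>\<Omega>. fst w \<le> fst Q)" using Q bnd by auto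
    fix z assume z: "z \<in> \<Omega> \<and> (\<forall>w\<in>\<Omega>. fst w \<le> fst z)"
    then have "fst z = fst b" using b Q(1) by (simp add: order_antisym)
    with k2[of z] z Q show "z = Q" by (simp add: prod_eq_iff)
  qed
  have "fst ` \<Omega> = {fst P..fst Q}"
  proof
    show "fst ` \<Omega> \<subseteq> {fst P..fst Q}" using bnd by auto
    have "connected (fst ` \<Omega>)"
      by (intro connected_continuous_image cont convex_connected cv)
    then show "{fst P..fst Q} \<subseteq> fst ` \<Omega>"
      using P(1) Q(1) by (intro connected_contains_Icc imageI)
  qed
  then have W: "x_width \<Omega> = fst Q - fst P" using PQ by (simp add: x_width_def)
  show ?thesis
  proof (rule that[OF P(1) Q(1) L R PQ W, of "max k1 k2"])
    show "0 \<le> max k1 k2" using P by auto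
    fix z assume z: "z \<in> \<Omega>"
    show "fst P \<le> fst z \<and> fst z \<le> fst Q" using bnd[OF z] .
    have "k1 * \<bar>fst z - fst a\<bar> \<le> max k1 k2 * \<bar>fst z - fst a\<bar>"
         "k2 * \<bar>fst z - fst b\<bar> \<le> max k1 k2 * \<bar>fst z - fst b\<bar>"
      by (auto intro!: mult_right_mono)
    with k1[OF z] k2[OF z] bnd[OF z] P Q
    show "\<bar>snd z - snd P\<bar> \<le> max k1 k2 * (fst z - fst P)"
         "\<bar>snd z - snd Q\<bar> \<le> max k1 k2 * (fst Q - fst z)"
      by auto
  qed
qed


section \<open>Slopes of the boundary at the extreme points\<close>

text \<open>
  The quotients \<open>h x / x\<close> increase as \<open>x\<close> decreases to 0 and are bounded by \<open>\<kappa>\<close>, so they converge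
  to their supremum, which is then both the one-sided derivative and the slope of a line above
  the graph.
\<close>
lemma concave_on_slope_at_zero:
  fixes h :: "real \<Rightarrow> real"
  assumes h: "concave_on {0..b} h" "h 0 = 0" and b: "0 < b"
    and bound: "\<And>x. x \<in> {0..b} \<Longrightarrow> h x \<le> \<kappa> * x"
  obtains d where "(h has_real_derivative d) (at 0 within {0..b})" "\<And>x. x \<in> {0..b} \<Longrightarrow> h x \<le> d * x"
proof -
  have anti: "h y / y \<le> h x / x" if "0 < x" "x \<le> y" "y \<le> b" for x y
  proof -
    have "h ((1 - x/y) *\<^sub>R 0 + (x/y) *\<^sub>R y) \<ge> (1 - x/y) * h 0 + x/y * h y"
      using that b by (intro concave_onD[OF h(1)]) auto
    then have "x / y * h y \<le> h x" using that h(2) by simp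
    then show ?thesis using that by (simp add: field_simps)
  qed
  define d where "d = (SUP x\<in>{0<..b}. h x / x)"
  have bdd: "bdd_above ((\<lambda>x. h x / x) ` {0<..b})"
    using bound by (intro bdd_aboveI[of _ \<kappa>]) (auto simp: divide_le_eq)
  have up: "h x / x \<le> d" if "x \<in> {0<..b}" for x
    unfolding d_def using bdd that by (intro cSUP_upper)
  have "((\<lambda>x. h x / x) \<longlongrightarrow> d) (at_right 0)"
  proof (rule order_tendstoI)
    fix a assume "a < d"
    then obtain x where x: "x \<in> {0<..b}" "a < h x / x"
      unfolding d_def using less_cSUP_iff[OF _ bdd] b by auto
    then have "\<forall>\<^sub>F y in at_right 0. y \<in> {0<..<x}"
      by (intro eventually_at_right_real) auto
    then show "\<forall>\<^sub>F y in at_right 0. a < h y / y"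
    proof eventually_elim
      case (elim y)
      then show ?case using x anti[of y x] by auto
    qed
  next
    fix a assume "d < a"
    have "\<forall>\<^sub>F y in at_right 0. y \<in> {0<..<b}"
      using b by (intro eventually_at_right_real) auto
    then show "\<forall>\<^sub>F y in at_right 0. h y / y < a"
    proof eventually_elim
      case (elim y)
      then show ?case using up[of y] \<open>d < a\<close> by auto
    qed
  qed
  then have "((\<lambda>x. h x / x) \<longlongrightarrow> d) (at 0 within {0..b})"
    using b by (simp add: at_within_Icc_at_right)
  then have "(h has_real_derivative d) (at 0 within {0..b})"
    by (simp add: has_field_derivative_iff h(2))
  moreover have "h x \<le> d * x" if "x \<in> {0..b}" for x
    using up[of x] that h(2) by (cases "x = 0") (auto simp: divide_le_eq)
  ultimately show ?thesis using that by blast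
qed

text \<open>
  The right endpoint is the left one of the reflected function \<open>x \<mapsto> h (b - x)\<close>.
\<close>
lemma concave_on_endpoint_slopes:
  fixes h :: "real \<Rightarrow> real"
  assumes h: "concave_on {0..b} h" "h 0 = 0" "h b = 0" and b: "0 < b"
    and bound: "\<And>x. x \<in> {0..b} \<Longrightarrow> h x \<le> \<kappa> * x" "\<And>x. x \<in> {0..b} \<Longrightarrow> h x \<le> \<kappa> * (b - x)"
  obtains d e where "(h has_vector_derivative d) (at 0 within {0..b})"
    "(h has_vector_derivative e) (at b within {0..b})"
    "\<And>x. x \<in> {0..b} \<Longrightarrow> h x \<le> d * x" "\<And>x. x \<in> {0..b} \<Longrightarrow> h x \<le> - e * (b - x)"
proof -
  obtain d where d: "(h has_real_derivative d) (at 0 within {0..b})" "\<And>x. x \<in> {0..b} \<Longrightarrow> h x \<le> d * x"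
    using concave_on_slope_at_zero[OF h(1,2) b bound(1)] by blast
  have "concave_on {0..b} (\<lambda>x. h (b - x))"
    unfolding concave_on_iff
  proof (intro conjI ballI allI impI)
    fix s t u v :: real assume st: "s \<in> {0..b}" "t \<in> {0..b}" and uv: "u \<ge> 0" "v \<ge> 0" "u + v = 1"
    have "u *\<^sub>R (b - s) + v *\<^sub>R (b - t) = b * (u + v) - (u *\<^sub>R s + v *\<^sub>R t)"
      by (simp add: algebra_simps)
    moreover have "u * h (b - s) + v * h (b - t) \<le> h (u *\<^sub>R (b - s) + v *\<^sub>R (b - t))"
      using st uv by (intro h(1)[unfolded concave_on_iff, THEN conjunct2, rule_format]) auto
    ultimately show "u * h (b - s) + v * h (b - t) \<le> h (b - (u *\<^sub>R s + v *\<^sub>R t))"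
      using uv(3) by simp
  qed auto
  then obtain e where e: "((\<lambda>x. h (b - x)) has_real_derivative e) (at 0 within {0..b})"
    "\<And>x. x \<in> {0..b} \<Longrightarrow> h (b - x) \<le> e * x"
    using concave_on_slope_at_zero[of b "\<lambda>x. h (b - x)" \<kappa>] h(3) b bound(2)
    by (smt (verit) atLeastAtMost_iff)
  have im: "(\<lambda>x. b - x) ` {0..b} = {0..b}" by (simp add: image_diff_atLeastAtMost)
  have "((\<lambda>x. h (b - x)) \<circ> (\<lambda>x. b - x) has_real_derivative e * (-1)) (at b within {0..b})"
  proof (rule DERIV_image_chain)
    show "((\<lambda>x. b - x) has_real_derivative -1) (at b within {0..b})"
      by (auto intro!: derivative_eq_intros)
    show "((\<lambda>x. h (b - x)) has_real_derivative e) (at (b - b) within (\<lambda>x. b - x) ` {0..b})"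
      using e(1) im by simp
  qed
  then have "(h has_real_derivative - e) (at b within {0..b})" by (simp add: o_def)
  moreover have "h x \<le> - (- e) * (b - x)" if "x \<in> {0..b}" for x
    using e(2)[of "b - x"] that by simp
  ultimately show ?thesis
    using d by (intro that[of d "- e"]) (auto simp: has_real_derivative_iff_has_vector_derivative)
qed

lemma compact_vertical_slice:
  fixes S :: "(real \<times> real) set"
  assumes "compact S"
  shows "compact {y. (x, y) \<in> S}"
proof -
  have "{y. (x, y) \<in> S} = snd ` (S \<inter> {z. fst z = x})" by force
  moreover have "closed {z :: real \<times> real. fst z = x}"
    by (intro closed_Collect_eq continuous_intros)
  ultimately show ?thesis
    using assms by (auto intro!: compact_continuous_image continuous_intros compact_Int_closed)
qed

text \<open>
  The cone given by \<open>\<kappa>\<close> only serves to make the four slopes finite; once they exist, concavity of the upper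
  graph and convexity of the lower one replace \<open>\<kappa>\<close> by the largest slope.
\<close>
lemma abs_snd_le_max_slope:
  assumes cp: "compact \<Omega>" and cv: "convex \<Omega>"
    and ends: "(0, 0) \<in> \<Omega>" "(2, 0) \<in> \<Omega>"
    and sub: "\<And>x y. (x, y) \<in> \<Omega> \<Longrightarrow> x \<in> {0..2}"
    and cone: "\<And>x y. (x, y) \<in> \<Omega> \<Longrightarrow> \<bar>y\<bar> \<le> \<kappa> * x" "\<And>x y. (x, y) \<in> \<Omega> \<Longrightarrow> \<bar>y\<bar> \<le> \<kappa> * (2 - x)"
    and xy: "(x, y) \<in> \<Omega>"
  shows "\<bar>y\<bar> \<le> max_slope \<Omega> * x" "\<bar>y\<bar> \<le> max_slope \<Omega> * (2 - x)"
proof -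
  let ?S = "\<lambda>x. {y. (x, y) \<in> \<Omega>}"
  have comp: "compact (?S x)" for x by (rule compact_vertical_slice[OF cp])
  have ne: "?S t \<noteq> {}" if "t \<in> {0..2}" for t
  proof -
    have "(1 - t/2) *\<^sub>R (0, 0) + (t/2) *\<^sub>R (2::real, 0::real) \<in> \<Omega>"
      using that by (intro convexD[OF cv ends]) auto
    then have "(t, 0) \<in> \<Omega>" by simp
    then show ?thesis by auto
  qed
  have lo: "(t, lower_graph \<Omega> t) \<in> \<Omega>" and up: "(t, upper_graph \<Omega> t) \<in> \<Omega>" if "t \<in> {0..2}" for t
    using closed_contains_Inf[OF ne[OF that]] closed_contains_Sup[OF ne[OF that]] comp[of t]
    by (auto simp: lower_graph_def upper_graph_def compact_imp_closed bounded_imp_bdd_below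
        bounded_imp_bdd_above compact_imp_bounded)
  have le: "lower_graph \<Omega> s \<le> t" and ge: "t \<le> upper_graph \<Omega> s" if "(s, t) \<in> \<Omega>" for s t
    unfolding lower_graph_def upper_graph_def using that comp[of s]
    by (auto intro!: cInf_lower cSup_upper
        simp: bounded_imp_bdd_below bounded_imp_bdd_above compact_imp_bounded)
  have cup: "concave_on {0..2} (upper_graph \<Omega>)"
    unfolding concave_on_iff
  proof (intro conjI ballI allI impI)
    fix s t u v :: real assume st: "s \<in> {0..2}" "t \<in> {0..2}" and uv: "u \<ge> 0" "v \<ge> 0" "u + v = 1"
    have "u *\<^sub>R (s, upper_graph \<Omega> s) + v *\<^sub>R (t, upper_graph \<Omega> t) \<in> \<Omega>"
      using uv by (intro convexD[OF cv] up st)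
    then show "u * upper_graph \<Omega> s + v * upper_graph \<Omega> t \<le> upper_graph \<Omega> (u *\<^sub>R s + v *\<^sub>R t)"
      by (intro ge) simp
  qed auto
  have clo: "concave_on {0..2} (\<lambda>t. - lower_graph \<Omega> t)"
    unfolding concave_on_iff
  proof (intro conjI ballI allI impI)
    fix s t u v :: real assume st: "s \<in> {0..2}" "t \<in> {0..2}" and uv: "u \<ge> 0" "v \<ge> 0" "u + v = 1"
    have "u *\<^sub>R (s, lower_graph \<Omega> s) + v *\<^sub>R (t, lower_graph \<Omega> t) \<in> \<Omega>"
      using uv by (intro convexD[OF cv] lo st)
    then have "lower_graph \<Omega> (u *\<^sub>R s + v *\<^sub>R t) \<le> u * lower_graph \<Omega> s + v * lower_graph \<Omega> t"
      by (intro le) simp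
    then show "u * - lower_graph \<Omega> s + v * - lower_graph \<Omega> t \<le> - lower_graph \<Omega> (u *\<^sub>R s + v *\<^sub>R t)"
      by simp
  qed auto
  have zero: "lower_graph \<Omega> 0 = 0" "upper_graph \<Omega> 0 = 0" "lower_graph \<Omega> 2 = 0" "upper_graph \<Omega> 2 = 0"
    using cone(1)[OF lo[of 0]] cone(1)[OF up[of 0]] cone(2)[OF lo[of 2]] cone(2)[OF up[of 2]] by auto
  have b: "upper_graph \<Omega> t \<le> \<kappa> * t" "upper_graph \<Omega> t \<le> \<kappa> * (2 - t)"
    "- lower_graph \<Omega> t \<le> \<kappa> * t" "- lower_graph \<Omega> t \<le> \<kappa> * (2 - t)" if "t \<in> {0..2}" for t
    using cone[OF lo[OF that]] cone[OF up[OF that]] by auto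
  have x: "x \<in> {0..2}" using sub xy .
  obtain du eu where u: "(upper_graph \<Omega> has_vector_derivative du) (at 0 within {0..2})"
    "(upper_graph \<Omega> has_vector_derivative eu) (at 2 within {0..2})"
    "\<And>x. x \<in> {0..2} \<Longrightarrow> upper_graph \<Omega> x \<le> du * x"
    "\<And>x. x \<in> {0..2} \<Longrightarrow> upper_graph \<Omega> x \<le> - eu * (2 - x)"
    using concave_on_endpoint_slopes[OF cup zero(2,4) _ b(1,2)] by auto
  obtain dl el where l: "((\<lambda>t. - lower_graph \<Omega> t) has_vector_derivative dl) (at 0 within {0..2})"
    "((\<lambda>t. - lower_graph \<Omega> t) has_vector_derivative el) (at 2 within {0..2})"
    "\<And>x. x \<in> {0..2} \<Longrightarrow> - lower_graph \<Omega> x \<le> dl * x"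
    "\<And>x. x \<in> {0..2} \<Longrightarrow> - lower_graph \<Omega> x \<le> - el * (2 - x)"
    using concave_on_endpoint_slopes[OF clo _ _ _ b(3,4)] zero by auto
  define S where "S = {\<bar>- dl\<bar>, \<bar>du\<bar>, \<bar>- el\<bar>, \<bar>eu\<bar>}"
  have S: "max_slope \<Omega> = Max S"
    unfolding max_slope_def S_def
    using vector_derivative_within_closed_interval[OF _ _ u(1)]
      vector_derivative_within_closed_interval[OF _ _ u(2)]
      vector_derivative_within_closed_interval[OF _ _ has_vector_derivative_minus[OF l(1)]]
      vector_derivative_within_closed_interval[OF _ _ has_vector_derivative_minus[OF l(2)]]
    by simp
  have "finite S" by (simp add: S_def)
  then have "r \<le> max_slope \<Omega>" if "\<bar>r\<bar> \<in> S" for r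
    using Max_ge[of S "\<bar>r\<bar>"] that S by linarith
  then have m: "du \<le> max_slope \<Omega>" "- eu \<le> max_slope \<Omega>" "dl \<le> max_slope \<Omega>" "- el \<le> max_slope \<Omega>"
    by (simp_all add: S_def)
  have "y \<le> upper_graph \<Omega> x" "- y \<le> - lower_graph \<Omega> x" using le ge xy by auto
  moreover have "du * x \<le> max_slope \<Omega> * x" "dl * x \<le> max_slope \<Omega> * x"
    "- eu * (2 - x) \<le> max_slope \<Omega> * (2 - x)" "- el * (2 - x) \<le> max_slope \<Omega> * (2 - x)"
    by (rule mult_right_mono[OF m(1)] mult_right_mono[OF m(2)] mult_right_mono[OF m(3)]
        mult_right_mono[OF m(4)], use x in simp)+
  moreover note u(3,4)[OF x] l(3,4)[OF x]
  ultimately show "\<bar>y\<bar> \<le> max_slope \<Omega> * x" "\<bar>y\<bar> \<le> max_slope \<Omega> * (2 - x)"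
    by (metis abs_le_iff order_trans)+
qed


section \<open>Partial derivatives of concave functions exist almost everywhere\<close>

lemma convex_on_subgradient:
  fixes f :: "real \<Rightarrow> real"
  assumes "convex_on S f" "open S"
  obtains g where "\<And>x y. x \<in> S \<Longrightarrow> y \<in> S \<Longrightarrow> f x + g x * (y - x) \<le> f y"
proof (rule that)
  fix x y assume "x \<in> S" "y \<in> S"
  then show "f x + Inf ((\<lambda>t. (f x - f t) / (x - t)) ` ({x<..} \<inter> S)) * (y - x) \<le> f y"
    using convex_le_Inf_differential[OF assms(1)] assms(2) by (simp add: interior_open)
qed

text \<open>
  A selection of subgradients is monotone, hence continuous outside a countable set, and at each
  point of continuity it is the derivative.
\<close>
lemma convex_on_countable_nondifferentiable:
  fixes f :: "real \<Rightarrow> real"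
  assumes "convex_on S f" "open S"
  shows "countable {x \<in> S. \<not> f differentiable (at x)}"
proof -
  obtain g where g: "\<And>x y. x \<in> S \<Longrightarrow> y \<in> S \<Longrightarrow> f x + g x * (y - x) \<le> f y"
    using convex_on_subgradient[OF assms] by blast
  have "mono_on S g"
  proof (rule mono_onI)
    fix r s assume rs: "r \<in> S" "s \<in> S" "r \<le> s"
    have "f r + g r * (s - r) \<le> f s" "f s + g s * (r - s) \<le> f r" using g rs by auto
    then have "(g r - g s) * (s - r) \<le> 0" by (simp add: algebra_simps)
    then show "g r \<le> g s" using rs(3) by (cases "r = s") (auto simp: mult_le_0_iff)
  qed
  then have "countable {a \<in> S. \<not> isCont g a}"
    using assms(2) by (rule mono_on_ctble_discont_open[rotated])
  moreover have "f differentiable (at a)" if a: "a \<in> S" and c: "isCont g a" for a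
  proof -
    have ev: "\<forall>\<^sub>F y in at a. y \<in> S"
      using assms(2) a by (simp add: eventually_at_in_open')
    have "((\<lambda>y. (f y - f a) / (y - a) - g a) \<longlongrightarrow> 0) (at a)"
    proof (rule Lim_null_comparison)
      show "((\<lambda>y. \<bar>g y - g a\<bar>) \<longlongrightarrow> 0) (at a)"
        using c unfolding isCont_def by (metis LIM_zero tendsto_rabs_zero)
      show "\<forall>\<^sub>F y in at a. norm ((f y - f a) / (y - a) - g a) \<le> \<bar>g y - g a\<bar>"
        using ev eventually_neq_at_within[of a]
      proof eventually_elim
        case (elim y)
        have 1: "0 \<le> f y - f a - g a * (y - a)" "f y - f a - g a * (y - a) \<le> (g y - g a) * (y - a)"
          using g[OF a elim(1)] g[OF elim(1) a] by (auto simp: algebra_simps)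
        then have "\<bar>f y - f a - g a * (y - a)\<bar> \<le> \<bar>g y - g a\<bar> * \<bar>y - a\<bar>"
          by (metis abs_mult abs_of_nonneg abs_ge_self order_trans)
        moreover have "(f y - f a) / (y - a) - g a = (f y - f a - g a * (y - a)) / (y - a)"
          using elim(2) by (simp add: field_simps)
        ultimately show ?case
          using elim(2) by (simp add: divide_le_eq)
      qed
    qed
    then have "(f has_real_derivative g a) (at a)"
      unfolding has_field_derivative_iff by (rule LIM_zero_cancel)
    then show ?thesis using real_differentiable_def by blast
  qed
  then have "{x \<in> S. \<not> f differentiable (at x)} \<subseteq> {a \<in> S. \<not> isCont g a}" by auto
  ultimately show ?thesis by (rule countable_subset[rotated])
qed

lemma has_real_derivative_imp_LIMSEQ:
  fixes f :: "real \<Rightarrow> real"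
  assumes "(f has_real_derivative d) (at a)" "c \<noteq> 0"
  shows "(\<lambda>n. real (Suc n) * (f (a + c / real (Suc n)) - f a)) \<longlonglongrightarrow> c * d"
proof -
  have "((\<lambda>h. (f (a + h) - f a) / h) \<longlongrightarrow> d) (at 0)"
    using assms(1) by (simp add: DERIV_def)
  moreover have "filterlim (\<lambda>n. c / real (Suc n)) (at 0) sequentially"
    unfolding filterlim_at
    using assms(2) tendsto_mult[OF tendsto_const LIMSEQ_inverse_real_of_nat, of c]
    by (auto simp: divide_inverse)
  ultimately have "(\<lambda>n. (f (a + c / real (Suc n)) - f a) / (c / real (Suc n))) \<longlonglongrightarrow> d"
    by (rule filterlim_compose)
  then have "(\<lambda>n. c * ((f (a + c / real (Suc n)) - f a) / (c / real (Suc n)))) \<longlonglongrightarrow> c * d"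
    by (intro tendsto_mult tendsto_const)
  moreover have "c * ((f (a + c / real (Suc n)) - f a) / (c / real (Suc n)))
      = real (Suc n) * (f (a + c / real (Suc n)) - f a)" for n
    using assms(2) by (simp add: field_simps)
  ultimately show ?thesis by simp
qed

text \<open>
  Scaled symmetric second differences. For a convex function their convergence to zero means that
  the one-sided derivatives agree; unlike differentiability itself, this is a Borel condition on the
  base point.
\<close>
definition second_difference :: "(real \<Rightarrow> real) \<Rightarrow> real \<Rightarrow> nat \<Rightarrow> real" where
  "second_difference f a n = real (Suc n) * (f (a + 1 / real (Suc n)) + f (a - 1 / real (Suc n)) - 2 * f a)"

lemma differentiable_imp_second_difference:
  fixes f :: "real \<Rightarrow> real"
  assumes "f differentiable (at a)"
  shows "second_difference f a \<longlonglongrightarrow> 0"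
proof -
  obtain d where d: "(f has_real_derivative d) (at a)"
    using assms real_differentiable_def by blast
  have "(\<lambda>n. real (Suc n) * (f (a + 1 / real (Suc n)) - f a)
           + real (Suc n) * (f (a + -1 / real (Suc n)) - f a)) \<longlonglongrightarrow> 1 * d + -1 * d"
    by (intro tendsto_add has_real_derivative_imp_LIMSEQ[OF d]) auto
  then show ?thesis
    unfolding second_difference_def by (simp add: algebra_simps)
qed

text \<open>
  With a subgradient \<open>g a\<close> at \<open>a\<close>, both \<open>f (a + h) - f a - g a * h\<close> and the same expression for
  \<open>-h\<close> are nonnegative, and their sum is a second difference. So each of them is small when the
  second difference is, and convexity carries the smallness at one \<open>h\<close> to all smaller ones.
\<close>
lemma second_difference_imp_differentiable:
  fixes f :: "real \<Rightarrow> real"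
  assumes f: "convex_on S f" and S: "open S" and a: "a \<in> S"
    and lim: "second_difference f a \<longlonglongrightarrow> 0"
  shows "f differentiable (at a)"
proof -
  obtain g where g: "\<And>x y. x \<in> S \<Longrightarrow> y \<in> S \<Longrightarrow> f x + g x * (y - x) \<le> f y"
    using convex_on_subgradient[OF f S] by blast
  obtain r where r: "r > 0" "ball a r \<subseteq> S" using S a openE by blast
  have "((\<lambda>h. (f (a + h) - f a) / h - g a) \<longlongrightarrow> 0) (at 0)"
  proof (rule tendstoI)
    fix e :: real assume e: "e > 0"
    have "\<forall>\<^sub>F n in sequentially. \<bar>second_difference f a n\<bar> < e"
      using tendstoD[OF lim e] by (simp add: dist_real_def)
    moreover have "\<forall>\<^sub>F n in sequentially. 1 / real (Suc n) < r"
      using lim_1_over_n[THEN LIMSEQ_Suc] r(1) by (intro order_tendstoD) (auto simp: inverse_eq_divide)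
    ultimately have "\<forall>\<^sub>F n in sequentially. \<bar>second_difference f a n\<bar> < e \<and> 1 / real (Suc n) < r"
      by eventually_elim auto
    then obtain n where n: "\<bar>second_difference f a n\<bar> < e" "1 / real (Suc n) < r"
      using eventually_happens by fastforce
    define \<delta> where "\<delta> = 1 / real (Suc n)"
    have \<delta>: "0 < \<delta>" "\<delta> < r" using n by (auto simp: \<delta>_def)
    have inS: "a + h \<in> S" if "\<bar>h\<bar> \<le> \<delta>" for h
      using that \<delta> r(2) by (auto simp: dist_real_def subset_iff)
    have sd: "f (a + \<delta>) + f (a - \<delta>) - 2 * f a < e * \<delta>"
      using n(1) \<delta>(1) by (auto simp: second_difference_def \<delta>_def field_simps)
    have gp: "f (a + \<delta>) \<ge> f a + g a * \<delta>" "f (a - \<delta>) \<ge> f a - g a * \<delta>"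
      using g[OF a inS[of \<delta>]] g[OF a inS[of "-\<delta>"]] \<delta> by auto
    have key: "0 \<le> f (a + h) - f a - g a * h \<and> f (a + h) - f a - g a * h < e * \<bar>h\<bar>"
      if h: "h \<noteq> 0" "\<bar>h\<bar> < \<delta>" for h
    proof
      show "0 \<le> f (a + h) - f a - g a * h" using g[OF a inS[of h]] h by auto
      \<comment> \<open>The endpoint of the interval around a on the side of h.\<close>
      define k where "k = sgn h * \<delta>"
      have k: "\<bar>k\<bar> = \<delta>" using h by (simp add: k_def abs_mult)
      have fk: "f (a + k) - f a - g a * k < e * \<delta>"
        using sd gp by (cases "h > 0") (use h in \<open>auto simp: k_def sgn_if\<close>)
      let ?t = "\<bar>h\<bar> / \<delta>"
      have t: "0 < ?t" "?t \<le> 1" using h \<delta> by auto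
      have tk: "?t * k = h" using h \<delta> by (auto simp: k_def sgn_if)
      have "(1 - ?t) *\<^sub>R a + ?t *\<^sub>R (a + k) = a + ?t * k" by (simp add: algebra_simps add_divide_distrib)
      then have "(1 - ?t) *\<^sub>R a + ?t *\<^sub>R (a + k) = a + h" using tk by simp
      then have "f (a + h) \<le> (1 - ?t) * f a + ?t * f (a + k)"
        using convex_onD[OF f, of ?t a "a + k"] t a inS[of k] k by (simp add: less_imp_le)
      then have "f (a + h) - f a - g a * h \<le> ?t * (f (a + k) - f a) - g a * (?t * k)"
        unfolding tk left_diff_distrib right_diff_distrib by linarith
      also have "\<dots> = ?t * (f (a + k) - f a - g a * k)" by (simp add: algebra_simps)
      also have "\<dots> < ?t * (e * \<delta>)" using fk t by (intro mult_strict_left_mono)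
      also have "\<dots> = e * \<bar>h\<bar>" using \<delta> by simp
      finally show "f (a + h) - f a - g a * h < e * \<bar>h\<bar>" .
    qed
    have "\<forall>\<^sub>F h in at 0. h \<noteq> 0 \<and> \<bar>h\<bar> < \<delta>"
      using \<delta>(1) by (auto simp: eventually_at intro!: exI[of _ \<delta>])
    then show "\<forall>\<^sub>F h in at 0. dist ((f (a + h) - f a) / h - g a) 0 < e"
    proof eventually_elim
      case (elim h)
      have "(f (a + h) - f a) / h - g a = (f (a + h) - f a - g a * h) / h"
        using elim by (simp add: field_simps)
      moreover have "\<bar>f (a + h) - f a - g a * h\<bar> < e * \<bar>h\<bar>" using key[of h] elim by auto
      ultimately show ?case using elim by (simp add: divide_less_eq)
    qed
  qed
  then have "(f has_real_derivative g a) (at a)"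
    unfolding DERIV_def by (rule LIM_zero_cancel)
  then show ?thesis using real_differentiable_def by blast
qed

lemma convex_on_slices:
  fixes u :: "real \<times> real \<Rightarrow> real"
  assumes "convex_on W u"
  shows "convex_on {t. (x, t) \<in> W} (\<lambda>t. u (x, t))" "convex_on {t. (t, y) \<in> W} (\<lambda>t. u (t, y))"
proof -
  have W: "convex W" using assms convex_on_imp_convex by blast
  have 1: "(x, a *\<^sub>R s + b *\<^sub>R t) = a *\<^sub>R (x, s) + b *\<^sub>R (x, t)"
    and 2: "(a *\<^sub>R s + b *\<^sub>R t, y) = a *\<^sub>R (s, y) + b *\<^sub>R (t, y)" if "a + b = 1" for a b s t
    using that by (auto simp: distrib_right[symmetric])
  have c: "u (a *\<^sub>R z + b *\<^sub>R w) \<le> a * u z + b * u w"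
    if "z \<in> W" "w \<in> W" "0 \<le> a" "0 \<le> b" "a + b = 1" for a b z w
    using assms that unfolding convex_on_def by blast
  show "convex_on {t. (x, t) \<in> W} (\<lambda>t. u (x, t))"
    unfolding convex_on_def
  proof (intro conjI ballI allI impI)
    show "convex {t. (x, t) \<in> W}"
      by (rule convexI) (simp only: mem_Collect_eq 1 convexD[OF W])
  qed (simp only: mem_Collect_eq 1 c)
  show "convex_on {t. (t, y) \<in> W} (\<lambda>t. u (t, y))"
    unfolding convex_on_def
  proof (intro conjI ballI allI impI)
    show "convex {t. (t, y) \<in> W}"
      by (rule convexI) (simp only: mem_Collect_eq 2 convexD[OF W])
  qed (simp only: mem_Collect_eq 2 c)
qed

lemma open_slices:
  fixes W :: "(real \<times> real) set"
  assumes W: "open W"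
  shows "open {t. (x, t) \<in> W}" "open {t. (t, y) \<in> W}"
  using open_vimage[OF W, of "\<lambda>t. (x, t)"] open_vimage[OF W, of "\<lambda>t. (t, y)"]
  by (simp_all add: vimage_def continuous_on_Pair)

text \<open>
  On each horizontal and each vertical line the bad points form a countable set. Fubini's theorem
  makes the bad set null, since second differences describe it as a Borel set.
\<close>
lemma AE_partials_differentiable:
  fixes u :: "real \<times> real \<Rightarrow> real"
  assumes u: "convex_on W u" and W: "open W" and [measurable]: "u \<in> borel_measurable borel"
  shows "AE z in lborel. z \<in> W \<longrightarrow> gradient_defined u z"
proof -
  have [measurable]: "W \<in> sets borel" using W by simp
  have [measurable]: "u \<in> borel_measurable (borel \<Otimes>\<^sub>M borel)" "W \<in> sets (borel \<Otimes>\<^sub>M borel)"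
    unfolding borel_prod by simp_all
  have slice: "AE t in lborel. t \<in> S \<longrightarrow> second_difference f t \<longlonglongrightarrow> 0"
    if "convex_on S f" "open S" for S f
  proof (rule AE_I')
    show "{x \<in> S. \<not> f differentiable (at x)} \<in> null_sets lborel"
      using convex_on_countable_nondifferentiable[OF that] by (rule countable_imp_null_set_lborel)
  qed (use differentiable_imp_second_difference in auto)
  note op = open_slices[OF W]
  have LIM: "(X \<longlonglongrightarrow> (0::real)) \<longleftrightarrow> (\<forall>k. \<exists>N. \<forall>n\<ge>N. \<bar>X n\<bar> < 1 / real (Suc k))" for X
  proof
    assume X: "X \<longlonglongrightarrow> 0"
    show "\<forall>k. \<exists>N. \<forall>n\<ge>N. \<bar>X n\<bar> < 1 / real (Suc k)"
      using LIMSEQ_D[OF X] by simp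
  next
    assume X: "\<forall>k. \<exists>N. \<forall>n\<ge>N. \<bar>X n\<bar> < 1 / real (Suc k)"
    show "X \<longlonglongrightarrow> 0"
    proof (rule LIMSEQ_I)
      fix r :: real assume "r > 0"
      then obtain k where "1 / real (Suc k) < r" by (rule nat_approx_posE)
      moreover obtain N where "\<forall>n\<ge>N. \<bar>X n\<bar> < 1 / real (Suc k)" using X by blast
      ultimately show "\<exists>N. \<forall>n\<ge>N. norm (X n - 0) < r" by (intro exI[of _ N]) force
    qed
  qed
  have "AE z in lborel \<Otimes>\<^sub>M lborel. z \<in> W \<longrightarrow> second_difference (\<lambda>t. u (fst z, t)) (snd z) \<longlonglongrightarrow> 0"
  proof (rule lborel_pair.AE_pair_measure)
    show "{z \<in> space (lborel \<Otimes>\<^sub>M lborel). z \<in> W \<longrightarrow> second_difference (\<lambda>t. u (fst z, t)) (snd z) \<longlonglongrightarrow> 0}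
        \<in> sets (lborel \<Otimes>\<^sub>M lborel)"
      unfolding LIM second_difference_def by measurable
    show "AE x in lborel. AE y in lborel. (x, y) \<in> W \<longrightarrow>
        second_difference (\<lambda>t. u (fst (x, y), t)) (snd (x, y)) \<longlonglongrightarrow> 0"
      using slice[OF convex_on_slices(1)[OF u] op(1)] by simp
  qed
  moreover have "AE z in lborel \<Otimes>\<^sub>M lborel. z \<in> W \<longrightarrow> second_difference (\<lambda>t. u (t, snd z)) (fst z) \<longlonglongrightarrow> 0"
  proof (rule lborel_pair.AE_pair_measure)
    show m: "{z \<in> space (lborel \<Otimes>\<^sub>M lborel). z \<in> W \<longrightarrow> second_difference (\<lambda>t. u (t, snd z)) (fst z) \<longlonglongrightarrow> 0}
        \<in> sets (lborel \<Otimes>\<^sub>M lborel)"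
      unfolding LIM second_difference_def by measurable
    have "AE y in lborel. AE x in lborel. (x, y) \<in> W \<longrightarrow> second_difference (\<lambda>t. u (t, y)) x \<longlonglongrightarrow> 0"
      using slice[OF convex_on_slices(2)[OF u] op(2)] by simp
    then show "AE x in lborel. AE y in lborel. (x, y) \<in> W \<longrightarrow>
        second_difference (\<lambda>t. u (t, snd (x, y))) (fst (x, y)) \<longlonglongrightarrow> 0"
      using lborel_pair.AE_commute[of "\<lambda>x y. (x, y) \<in> W \<longrightarrow> second_difference (\<lambda>t. u (t, y)) x \<longlonglongrightarrow> 0"] m
      by simp
  qed
  ultimately have "AE z in lborel. z \<in> W \<longrightarrow> second_difference (\<lambda>t. u (fst z, t)) (snd z) \<longlonglongrightarrow> 0 \<and>
       second_difference (\<lambda>t. u (t, snd z)) (fst z) \<longlonglongrightarrow> 0"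
    unfolding lborel_prod by eventually_elim auto
  then show ?thesis
  proof eventually_elim
    case (elim z)
    then show ?case unfolding gradient_defined_def
      using second_difference_imp_differentiable[OF convex_on_slices(1)[OF u] op(1), of "snd z" "fst z"]
        second_difference_imp_differentiable[OF convex_on_slices(2)[OF u] op(2), of "fst z" "snd z"]
      by auto
  qed
qed

text \<open>
  An admissible function has arbitrary values outside the domain and so need not be measurable on
  the whole plane; its extension by zero is.
\<close>
definition zero_extension :: "'a set \<Rightarrow> ('a \<Rightarrow> real) \<Rightarrow> 'a \<Rightarrow> real" where
  "zero_extension S u z = (if z \<in> S then u z else 0)"

lemma borel_measurable_zero_extension:
  fixes u :: "'a::topological_space \<Rightarrow> real"
  assumes "continuous_on S u" "S \<in> sets borel"
  shows "zero_extension S u \<in> borel_measurable borel"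
proof -
  have "zero_extension S u = (\<lambda>z. indicator S z *\<^sub>R u z)"
    by (auto simp: zero_extension_def fun_eq_iff)
  then show ?thesis using borel_measurable_continuous_on_indicator[OF assms(2,1)] by simp
qed

lemma differentiable_transform_open:
  fixes f g :: "real \<Rightarrow> real"
  assumes "f differentiable (at a)" "open S" "a \<in> S" "\<And>x. x \<in> S \<Longrightarrow> f x = g x"
  shows "g differentiable (at a)"
proof -
  obtain D where "(f has_real_derivative D) (at a)"
    using assms(1) real_differentiable_def by blast
  then have "(g has_real_derivative D) (at a)"
    by (rule has_field_derivative_transform_within_open[OF _ assms(2-4)])
  then show ?thesis using real_differentiable_def by blast
qed

lemma AE_gradient_defined:
  fixes u :: "real \<times> real \<Rightarrow> real"
  assumes u: "concave_on \<Omega> u" "continuous_on \<Omega> u" and \<Omega>: "compact \<Omega>"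
  shows "AE z in lborel. z \<in> interior \<Omega> \<longrightarrow> gradient_defined u z"
proof -
  let ?f = "\<lambda>z. - zero_extension \<Omega> u z"
  let ?W = "interior \<Omega>"
  have [measurable]: "zero_extension \<Omega> u \<in> borel_measurable borel"
    using u(2) \<Omega> by (intro borel_measurable_zero_extension borel_compact)
  have "convex_on \<Omega> (\<lambda>z. - u z)" using u(1) by (simp add: concave_on_def)
  then have "convex_on ?W (\<lambda>z. - u z)"
    using interior_subset by (rule convex_on_subset) (simp add: convex_interior concave_on_imp_convex[OF u(1)])
  moreover have "?f z = - u z" if "z \<in> ?W" for z
    using interior_subset[of \<Omega>] that by (auto simp: zero_extension_def)
  ultimately have "convex_on ?W ?f"
    using convexD[of ?W] by (simp add: convex_on_def)
  then have "AE z in lborel. z \<in> ?W \<longrightarrow> gradient_defined ?f z"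
    by (rule AE_partials_differentiable) auto
  then show ?thesis
  proof eventually_elim
    case (elim z)
    show ?case
    proof
      assume z: "z \<in> ?W"
      have eq: "zero_extension \<Omega> u w = u w" if "w \<in> ?W" for w
        using interior_subset[of \<Omega>] that by (auto simp: zero_extension_def)
      have "gradient_defined ?f z" using elim z by simp
      then have d: "(\<lambda>t. zero_extension \<Omega> u (t, snd z)) differentiable at (fst z)"
        "(\<lambda>t. zero_extension \<Omega> u (fst z, t)) differentiable at (snd z)"
        unfolding gradient_defined_def by (auto dest: differentiable_minus)
      have "(\<lambda>t. u (t, snd z)) differentiable at (fst z)"
        by (rule differentiable_transform_open[OF d(1) open_slices(2)[OF open_interior, of "snd z" \<Omega>]])
          (use z eq in auto)
      moreover have "(\<lambda>t. u (fst z, t)) differentiable at (snd z)"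
        by (rule differentiable_transform_open[OF d(2) open_slices(1)[OF open_interior, of "fst z" \<Omega>]])
          (use z eq in auto)
      ultimately show "gradient_defined u z" by (simp add: gradient_defined_def)
    qed
  qed
qed


section \<open>Tangent planes and the Lipschitz property\<close>

text \<open>
  Existence of the two partial derivatives suffices, without total differentiability. Let \<open>m\<close> be a
  point slightly beyond \<open>z\<close> on the line from \<open>w\<close> through \<open>z\<close>. Concavity along that line bounds
  \<open>u w - u z\<close> by a difference quotient of \<open>u\<close> between \<open>z\<close> and \<open>m\<close>. As \<open>m\<close> is the midpoint of two points that differ
  from \<open>z\<close> in one coordinate only, concavity bounds \<open>u m\<close> from below by values of \<open>u\<close> whose first-order
  behaviour is given by the partial derivatives.
\<close>
lemma concave_on_le_tangent_plane:
  fixes u :: "real \<times> real \<Rightarrow> real"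
  assumes u: "concave_on \<Omega> u" and z: "z \<in> interior \<Omega>" and g: "gradient_defined u z" and w: "w \<in> \<Omega>"
  shows "u w \<le> u z + partial_x u z * (fst w - fst z) + partial_y u z * (snd w - snd z)"
proof -
  obtain x y where zxy: "z = (x, y)" by fastforce
  define a b where "a = fst w - x" and "b = snd w - y"
  have wab: "w = (x + a, y + b)" by (simp add: a_def b_def)
  \<comment> \<open>A lower bound for u m - u z, where m = z - t (a, b) is the point beyond z.\<close>
  define \<phi> where "\<phi> t = (u (x - 2 * a * t, y) + u (x, y - 2 * b * t)) / 2 - u z" for t
  define L where "L = a * partial_x u z + b * partial_y u z"
  have dx: "((\<lambda>t. u (t, y)) has_real_derivative partial_x u z) (at x)"
    and dy: "((\<lambda>t. u (x, t)) has_real_derivative partial_y u z) (at y)"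
    using g by (auto simp: gradient_defined_def partial_x_def partial_y_def zxy DERIV_deriv_iff_real_differentiable)
  have "((\<lambda>t. u (x - 2 * a * t, y)) has_real_derivative partial_x u z * (- 2 * a)) (at 0)"
    by (rule DERIV_chain'[where g = "\<lambda>t. u (t, y)"]) (use dx in \<open>auto intro!: derivative_eq_intros\<close>)
  moreover have "((\<lambda>t. u (x, y - 2 * b * t)) has_real_derivative partial_y u z * (- 2 * b)) (at 0)"
    by (rule DERIV_chain'[where g = "\<lambda>t. u (x, t)"]) (use dy in \<open>auto intro!: derivative_eq_intros\<close>)
  ultimately have "(\<phi> has_real_derivative
      (partial_x u z * (- 2 * a) + partial_y u z * (- 2 * b)) / 2 - 0) (at 0)"
    unfolding \<phi>_def by (intro DERIV_diff DERIV_cdivide DERIV_add DERIV_const)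
  then have "(\<phi> has_real_derivative - L) (at 0)"
    by (simp add: L_def algebra_simps add_divide_distrib diff_divide_distrib)
  then have "((\<lambda>t. \<phi> t / t) \<longlongrightarrow> - L) (at 0)"
    by (simp add: DERIV_def \<phi>_def zxy)
  then have lim: "((\<lambda>t. - (\<phi> t / t)) \<longlongrightarrow> L) (at_right 0)"
    using tendsto_minus[of _ "- L"] by (fastforce intro: tendsto_within_subset)
  have "((\<lambda>t. (x - 2 * a * t, y)) \<longlongrightarrow> (x - 2 * a * 0, y)) (at_right 0)"
    "((\<lambda>t. (x, y - 2 * b * t)) \<longlongrightarrow> (x, y - 2 * b * 0)) (at_right 0)"
    by (intro tendsto_intros)+
  then have ev: "\<forall>\<^sub>F t in at_right 0. (x - 2 * a * t, y) \<in> interior \<Omega>"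
    "\<forall>\<^sub>F t in at_right 0. (x, y - 2 * b * t) \<in> interior \<Omega>"
    using z zxy by (auto elim!: topological_tendstoD)
  have "\<forall>\<^sub>F t in at_right 0. u w - u z \<le> - (\<phi> t / t)"
    using ev eventually_at_right_less[of 0]
  proof eventually_elim
    case (elim t)
    then have in\<Omega>: "(x - 2 * a * t, y) \<in> \<Omega>" "(x, y - 2 * b * t) \<in> \<Omega>"
      using interior_subset by blast+
    define m where "m = (x - a * t, y - b * t)"
    have m: "m = (1 - 1/2) *\<^sub>R (x - 2 * a * t, y) + (1/2) *\<^sub>R (x, y - 2 * b * t)"
      by (simp add: m_def field_simps)
    have m\<Omega>: "m \<in> \<Omega>"
      unfolding m using concave_on_imp_convex[OF u] in\<Omega> by (intro convexD) auto
    have um: "\<phi> t + u z \<le> u m"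
      unfolding m using concave_onD[OF u _ _ in\<Omega>, of "1/2"] by (simp add: \<phi>_def add_divide_distrib)
    let ?s = "t / (1 + t)"
    have s: "1 - ?s = 1 / (1 + t)" using elim by (simp add: field_simps)
    have zm: "z = (1 - ?s) *\<^sub>R m + ?s *\<^sub>R w"
      unfolding s m_def wab zxy using elim by (simp add: divide_simps) (simp add: algebra_simps)
    have "(1 - ?s) * u m + ?s * u w \<le> u z"
      using concave_onD[OF u _ _ m\<Omega> w, of ?s] elim zm by simp
    then have "(1 + t) * (1 / (1 + t) * u m + ?s * u w) \<le> (1 + t) * u z"
      unfolding s using elim by (intro mult_left_mono) auto
    then have "u m + t * u w \<le> (1 + t) * u z"
      using elim by (simp add: distrib_left)
    then have "t * (u w - u z) \<le> - \<phi> t" using um by (simp add: algebra_simps)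
    then show ?case using elim by (simp add: field_simps)
  qed
  then have "u w - u z \<le> L"
    by (intro tendsto_lowerbound[OF lim]) auto
  then show ?thesis by (simp add: L_def a_def b_def zxy algebra_simps)
qed

text \<open>
  At points with a gradient the tangent plane gives \<open>u w \<le> u z + B * dist w z\<close>. Such points are
  dense, so by continuity the inequality holds for all \<open>z\<close> and \<open>w\<close>.
\<close>
lemma admissible_lipschitz:
  assumes dom: "convex_compact_domain \<Omega>" and u: "u \<in> admissible \<Omega>"
  obtains B where "0 \<le> B" "\<And>z w. z \<in> \<Omega> \<Longrightarrow> w \<in> \<Omega> \<Longrightarrow> \<bar>u w - u z\<bar> \<le> B * dist w z"
proof -
  have \<Omega>: "compact \<Omega>" "convex \<Omega>" "interior \<Omega> \<noteq> {}"
    using dom by (auto simp: convex_compact_domain_def)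
  obtain B where cont: "continuous_on \<Omega> u" and conc: "concave_on \<Omega> u"
    and B: "\<And>z. z \<in> interior \<Omega> \<Longrightarrow> gradient_defined u z \<Longrightarrow> norm (partial_x u z, partial_y u z) \<le> B"
    using u by (auto simp: admissible_def)
  define G where "G = {z \<in> interior \<Omega>. gradient_defined u z}"
  have "negligible {z \<in> interior \<Omega>. \<not> gradient_defined u z}"
  proof -
    obtain N where N: "{z \<in> space lborel. \<not> (z \<in> interior \<Omega> \<longrightarrow> gradient_defined u z)} \<subseteq> N"
      "emeasure lborel N = 0" "N \<in> sets lborel"
      by (rule AE_E[OF AE_gradient_defined[OF conc cont \<Omega>(1)]])
    then have "negligible N"
      by (auto simp: negligible_iff_null_sets intro!: null_sets_completionI)
    then show ?thesis by (rule negligible_subset) (use N(1) in auto)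
  qed
  then have neg: "negligible V" if "V \<subseteq> interior \<Omega>" "V \<inter> G = {}" for V
    by (rule negligible_subset) (use that in \<open>auto simp: G_def\<close>)
  have "interior \<Omega> \<subseteq> closure G"
  proof
    fix z assume z: "z \<in> interior \<Omega>"
    show "z \<in> closure G"
      unfolding closure_iff_nhds_not_empty
    proof (intro allI impI)
      fix A V assume "V \<subseteq> A" "open V" "z \<in> V"
      then have "\<not> negligible (V \<inter> interior \<Omega>)"
        using z by (intro open_not_negligible) auto
      with neg[of "V \<inter> interior \<Omega>"] \<open>V \<subseteq> A\<close> show "G \<inter> A \<noteq> {}" by blast
    qed
  qed
  have clG: "closure G = \<Omega>"
  proof
    show "closure G \<subseteq> \<Omega>"
      using interior_subset compact_imp_closed[OF \<Omega>(1)] by (intro closure_minimal) (auto simp: G_def)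
    have "\<Omega> \<subseteq> closure (interior \<Omega>)"
      using closure_subset by (simp add: convex_closure_interior[OF \<Omega>(2,3)])
    also have "\<dots> \<subseteq> closure G"
      using \<open>interior \<Omega> \<subseteq> closure G\<close> by (intro closure_minimal) auto
    finally show "\<Omega> \<subseteq> closure G" .
  qed
  have le: "0 \<le> u z + \<bar>B\<bar> * dist w z - u w" if zw: "z \<in> \<Omega>" "w \<in> \<Omega>" for z w
  proof (rule continuous_ge_on_closure[of G "\<lambda>z. u z + \<bar>B\<bar> * dist w z - u w"])
    show "continuous_on (closure G) (\<lambda>z. u z + \<bar>B\<bar> * dist w z - u w)"
      unfolding clG by (intro continuous_intros cont)
    show "z \<in> closure G" using zw clG by simp
    fix v assume "v \<in> G"
    then have v: "v \<in> interior \<Omega>" "gradient_defined u v" by (auto simp: G_def)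
    have "u w - u v \<le> (partial_x u v, partial_y u v) \<bullet> (w - v)"
      using concave_on_le_tangent_plane[OF conc v zw(2)] by (cases w; cases v) simp
    also have "\<dots> \<le> norm (partial_x u v, partial_y u v) * norm (w - v)"
      by (rule norm_cauchy_schwarz)
    also have "\<dots> \<le> \<bar>B\<bar> * norm (w - v)"
      using B[OF v] by (intro mult_right_mono) auto
    finally show "0 \<le> u v + \<bar>B\<bar> * dist w v - u w" by (simp add: dist_norm)
  qed
  show ?thesis
  proof (rule that[of "\<bar>B\<bar>"])
    fix z w assume "z \<in> \<Omega>" "w \<in> \<Omega>"
    then show "\<bar>u w - u z\<bar> \<le> \<bar>B\<bar> * dist w z"
      using le[of z w] le[of w z] by (simp add: dist_commute)
  qed simp
qed


section \<open>The Poincare inequality on an interval\<close>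

lemma lipschitz_imp_abs_continuous_on:
  assumes lip: "\<And>s t. s \<in> {a..b} \<Longrightarrow> t \<in> {a..b} \<Longrightarrow> \<bar>v t - v s\<bar> \<le> L * \<bar>t - s\<bar>" and L: "0 \<le> L"
  shows "abs_continuous_on a b v"
  unfolding abs_continuous_on_def
proof (intro allI impI)
  fix \<epsilon> :: real assume e: "\<epsilon> > 0"
  show "\<exists>\<delta>>0. \<forall>D :: (real \<times> real) set. finite D \<and> (\<forall>(s, t)\<in>D. a \<le> s \<and> s < t \<and> t \<le> b) \<and>
      pairwise (\<lambda>(s, t) (s', t'). {s<..<t} \<inter> {s'<..<t'} = {}) D \<and>
      (\<Sum>(s, t)\<in>D. t - s) < \<delta> \<longrightarrow> (\<Sum>(s, t)\<in>D. \<bar>v t - v s\<bar>) < \<epsilon>"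
  proof (intro exI[of _ "\<epsilon> / (L + 1)"] conjI allI impI)
    show "0 < \<epsilon> / (L + 1)" using e L by simp
    fix D :: "(real \<times> real) set"
    assume D: "finite D \<and> (\<forall>(s, t)\<in>D. a \<le> s \<and> s < t \<and> t \<le> b) \<and>
      pairwise (\<lambda>(s, t) (s', t'). {s<..<t} \<inter> {s'<..<t'} = {}) D \<and>
      (\<Sum>(s, t)\<in>D. t - s) < \<epsilon> / (L + 1)"
    have "(\<Sum>(s, t)\<in>D. \<bar>v t - v s\<bar>) \<le> (\<Sum>(s, t)\<in>D. (L + 1) * (t - s))"
    proof (rule sum_mono, clarify)
      fix s t assume "(s, t) \<in> D"
      then have st: "a \<le> s" "s < t" "t \<le> b" using D by auto
      then have "\<bar>v t - v s\<bar> \<le> L * (t - s)" using lip[of s t] by auto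
      also have "\<dots> \<le> (L + 1) * (t - s)" using st by (intro mult_right_mono) auto
      finally show "\<bar>v t - v s\<bar> \<le> (L + 1) * (t - s)" .
    qed
    also have "\<dots> = (L + 1) * (\<Sum>(s, t)\<in>D. t - s)"
      by (simp add: sum_distrib_left case_prod_beta)
    also have "\<dots> < \<epsilon>" using D L by (simp add: less_divide_eq mult.commute)
    finally show "(\<Sum>(s, t)\<in>D. \<bar>v t - v s\<bar>) < \<epsilon>" .
  qed
qed

lemma lipschitz_derivative_bound:
  fixes v :: "real \<Rightarrow> real"
  assumes lip: "\<And>s t. s \<in> S \<Longrightarrow> t \<in> S \<Longrightarrow> \<bar>v t - v s\<bar> \<le> L * \<bar>t - s\<bar>"
    and S: "open S" "t \<in> S" and d: "(v has_real_derivative d) (at t)"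
  shows "\<bar>d\<bar> \<le> L"
proof -
  have "((\<lambda>s. \<bar>(v s - v t) / (s - t)\<bar>) \<longlongrightarrow> \<bar>d\<bar>) (at t)"
    using d unfolding has_field_derivative_iff by (rule tendsto_rabs)
  moreover have "\<forall>\<^sub>F s in at t. s \<in> S" using S by (simp add: eventually_at_in_open')
  then have "\<forall>\<^sub>F s in at t. \<bar>(v s - v t) / (s - t)\<bar> \<le> L"
    using eventually_neq_at_within[of t]
  proof eventually_elim
    case (elim s)
    then show ?case using lip[of t s] S(2) by (simp add: divide_le_eq)
  qed
  ultimately show ?thesis by (rule tendsto_upperbound) simp
qed

lemma AE_lborel_countable:
  fixes N :: "'a::euclidean_space set"
  assumes "countable N"
  shows "AE t in lborel. t \<notin> N"
  using countable_imp_null_set_lborel[OF assms] by (rule AE_not_in)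

text \<open>
  Passage from Bochner integrals with respect to the completed measure to nonnegative integrals
  with respect to \<open>lborel\<close>, where Fubini's theorem is available; on the way an integrand that is not known to
  be Borel, such as one built from \<open>deriv\<close>, is replaced by a Borel one.
\<close>
lemma nn_integral_set_lebesgue:
  assumes int: "set_integrable lebesgue S f" and nn: "\<And>t. t \<in> S \<Longrightarrow> 0 \<le> f t"
    and ae: "AE t in lborel. t \<in> S \<longrightarrow> f t = g t"
  shows "ennreal (LINT t:S|lebesgue. f t) = (\<integral>\<^sup>+ t. ennreal (g t) * indicator S t \<partial>lborel)"
proof -
  have "ennreal (LINT t:S|lebesgue. f t) = (\<integral>\<^sup>+ t. ennreal (indicator S t *\<^sub>R f t) \<partial>lebesgue)"
    using int nn unfolding set_lebesgue_integral_def set_integrable_def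
    by (intro nn_integral_eq_integral[symmetric]) (auto simp: indicator_def)
  also have "\<dots> = (\<integral>\<^sup>+ t. ennreal (g t) * indicator S t \<partial>lborel)"
    unfolding nn_integral_completion
    using ae by (intro nn_integral_cong_AE) (auto simp: indicator_def elim: eventually_mono)
  finally show ?thesis .
qed

text \<open>
  The hypothesis of the Poincare inequality about \<open>deriv v\<close> holds because the
  derivative of a Lipschitz function is bounded.
\<close>
lemma poincare_unit_interval:
  fixes v :: "real \<Rightarrow> real"
  assumes p: "1 < p" and pc: "poincare_constant p C"
    and lip: "\<And>s t. s \<in> {0..1} \<Longrightarrow> t \<in> {0..1} \<Longrightarrow> \<bar>v t - v s\<bar> \<le> L * \<bar>t - s\<bar>" and L: "0 \<le> L"
    and v: "v 0 = 0" "v 1 = 0"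
    and N: "countable N" and D: "\<And>t. t \<in> {0<..<1} \<Longrightarrow> t \<notin> N \<Longrightarrow> (v has_real_derivative D t) (at t)"
    and [measurable]: "D \<in> borel_measurable borel"
  shows "(\<integral>\<^sup>+ t. ennreal (\<bar>v t\<bar> powr p) * indicator {0..1} t \<partial>lborel)
    \<le> ennreal C * (\<integral>\<^sup>+ t. ennreal (\<bar>D t\<bar> powr p) * indicator {0..1} t \<partial>lborel)"
proof -
  let ?N = "N \<union> {0, 1}"
  have cN: "countable ?N" using N by simp
  then have negN: "negligible ?N"
    by (auto simp: negligible_iff_null_sets intro!: null_sets_completionI countable_imp_null_set_lborel)
  have dv: "deriv v t = D t" "\<bar>D t\<bar> \<le> L" if "t \<in> {0..1}" "t \<notin> ?N" for t
  proof -
    have d: "(v has_real_derivative D t) (at t)" using D that by auto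
    then show "deriv v t = D t" by (rule DERIV_imp_deriv)
    show "\<bar>D t\<bar> \<le> L"
      by (rule lipschitz_derivative_bound[OF lip _ _ d, of "{0<..<1}"]) (use that in auto)
  qed
  \<comment> \<open>Equal to the p-th power of the derivative almost everywhere, but bounded everywhere.\<close>
  define h where "h t = (if \<bar>D t\<bar> \<le> L then \<bar>D t\<bar> powr p else 0)" for t
  have [measurable]: "h \<in> borel_measurable borel" unfolding h_def by measurable
  have "set_integrable lborel {0..1} h"
    unfolding set_integrable_def
  proof (rule integrableI_bounded_set[where A = "{0..1}" and B = "L powr p"])
    show "AE t in lborel. t \<in> {0..1} \<longrightarrow> norm (indicator {0..1} t *\<^sub>R h t) \<le> L powr p"
      using p by (auto simp: h_def indicator_def intro!: powr_mono2)
  qed auto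
  then have "h absolutely_integrable_on {0..1}"
    unfolding set_integrable_def by (simp add: integrable_completion)
  then have int: "set_integrable lebesgue {0..1} (\<lambda>t. \<bar>deriv v t\<bar> powr p)"
    by (rule absolutely_integrable_spike[where S = ?N])
      (use dv negN in \<open>auto simp: h_def\<close>)
  have cont: "continuous_on {0..1} v"
  proof (rule continuous_on_iff[THEN iffD2], intro ballI allI impI)
    fix s e :: real assume s: "s \<in> {0..1}" and e: "0 < e"
    show "\<exists>d>0. \<forall>t\<in>{0..1}. dist t s < d \<longrightarrow> dist (v t) (v s) < e"
    proof (intro exI[of _ "e / (L + 1)"] conjI ballI impI)
      show "0 < e / (L + 1)" using e L by simp
      fix t assume t: "t \<in> {0..1}" and "dist t s < e / (L + 1)"
      then have "(L + 1) * \<bar>t - s\<bar> < e" using L by (simp add: dist_real_def less_divide_eq mult.commute)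
      moreover have "L * \<bar>t - s\<bar> \<le> (L + 1) * \<bar>t - s\<bar>" by (intro mult_right_mono) auto
      ultimately show "dist (v t) (v s) < e" using lip[OF s t] by (simp add: dist_real_def)
    qed
  qed
  have "set_integrable lebesgue {0..1} (\<lambda>t. \<bar>v t\<bar> powr p)"
    using p by (intro absolutely_integrable_continuous_real continuous_on_powr' continuous_intros cont) auto
  then have 1: "ennreal (LINT t:{0..1}|lebesgue. \<bar>v t\<bar> powr p)
      = (\<integral>\<^sup>+ t. ennreal (\<bar>v t\<bar> powr p) * indicator {0..1} t \<partial>lborel)"
    by (rule nn_integral_set_lebesgue) auto
  have 2: "ennreal (LINT t:{0..1}|lebesgue. \<bar>deriv v t\<bar> powr p)
      = (\<integral>\<^sup>+ t. ennreal (\<bar>D t\<bar> powr p) * indicator {0..1} t \<partial>lborel)"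
    using int
  proof (rule nn_integral_set_lebesgue)
    show "AE t in lborel. t \<in> {0..1} \<longrightarrow> \<bar>deriv v t\<bar> powr p = \<bar>D t\<bar> powr p"
      using AE_lborel_countable[OF cN] by eventually_elim (use dv in auto)
  qed auto
  have "abs_continuous_on 0 1 v" using lip L by (rule lipschitz_imp_abs_continuous_on)
  then have "(LINT t:{0..1}|lebesgue. \<bar>v t\<bar> powr p) \<le> C * (LINT t:{0..1}|lebesgue. \<bar>deriv v t\<bar> powr p)"
    using pc int v by (auto simp: poincare_constant_def)
  moreover have "0 \<le> (LINT t:{0..1}|lebesgue. \<bar>deriv v t\<bar> powr p)"
    unfolding set_lebesgue_integral_def by (intro integral_nonneg_AE) auto
  ultimately show ?thesis
    unfolding 1[symmetric] 2[symmetric] by (simp add: ennreal_leI flip: ennreal_mult'')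
qed

lemma poincare_interval:
  fixes f :: "real \<Rightarrow> real"
  assumes p: "1 < p" and pc: "poincare_constant p C" and ab: "\<alpha> < \<beta>"
    and lip: "\<And>s t. s \<in> {\<alpha>..\<beta>} \<Longrightarrow> t \<in> {\<alpha>..\<beta>} \<Longrightarrow> \<bar>f t - f s\<bar> \<le> L * \<bar>t - s\<bar>" and L: "0 \<le> L"
    and f: "f \<alpha> = 0" "f \<beta> = 0"
    and N: "countable N" and D: "\<And>t. t \<in> {\<alpha><..<\<beta>} \<Longrightarrow> t \<notin> N \<Longrightarrow> (f has_real_derivative D t) (at t)"
    and [measurable]: "D \<in> borel_measurable borel" "f \<in> borel_measurable borel"
  shows "(\<integral>\<^sup>+ t. ennreal (\<bar>f t\<bar> powr p) * indicator {\<alpha>..\<beta>} t \<partial>lborel)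
    \<le> ennreal C * ennreal ((\<beta> - \<alpha>) powr p) * (\<integral>\<^sup>+ t. ennreal (\<bar>D t\<bar> powr p) * indicator {\<alpha>..\<beta>} t \<partial>lborel)"
proof -
  define l where "l = \<beta> - \<alpha>"
  have l: "l > 0" and \<beta>: "\<beta> = \<alpha> + l" using ab by (simp_all add: l_def)
  have in01: "\<alpha> + l * t \<in> {\<alpha>..\<beta>} \<longleftrightarrow> t \<in> {0..1}" for t
    using mult_le_cancel_left_pos[OF l, of t 1] l by (auto simp: \<beta> zero_le_mult_iff)
  have ind: "indicator {\<alpha>..\<beta>} (\<alpha> + l * t) = (indicator {0..1} t :: ennreal)" for t
    using in01[of t] by (auto simp: indicator_def)
  have scale: "(\<integral>\<^sup>+ t. ennreal (\<bar>g t\<bar> powr p) * indicator {\<alpha>..\<beta>} t \<partial>lborel)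
      = ennreal l * (\<integral>\<^sup>+ t. ennreal (\<bar>g (\<alpha> + l * t)\<bar> powr p) * indicator {0..1} t \<partial>lborel)"
    if [measurable]: "g \<in> borel_measurable borel" for g
    using l by (subst nn_integral_real_affine[where c = l and t = \<alpha>]) (simp_all add: ind)
  have "(\<integral>\<^sup>+ t. ennreal (\<bar>f (\<alpha> + l * t)\<bar> powr p) * indicator {0..1} t \<partial>lborel)
     \<le> ennreal C * (\<integral>\<^sup>+ t. ennreal (\<bar>D (\<alpha> + l * t) * l\<bar> powr p) * indicator {0..1} t \<partial>lborel)"
  proof (rule poincare_unit_interval[OF p pc, where L = "L * l" and N = "(\<lambda>t. \<alpha> + l * t) -` N"])
    fix s t :: real assume "s \<in> {0..1}" "t \<in> {0..1}"
    then have "\<bar>f (\<alpha> + l * t) - f (\<alpha> + l * s)\<bar> \<le> L * \<bar>(\<alpha> + l * t) - (\<alpha> + l * s)\<bar>"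
      using in01 by (intro lip) auto
    also have "(\<alpha> + l * t) - (\<alpha> + l * s) = l * (t - s)" by (simp add: algebra_simps)
    finally show "\<bar>f (\<alpha> + l * t) - f (\<alpha> + l * s)\<bar> \<le> L * l * \<bar>t - s\<bar>"
      using l by (simp add: abs_mult)
  next
    have "(\<lambda>t. \<alpha> + l * t) -` N \<subseteq> (\<lambda>y. (y - \<alpha>) / l) ` N"
    proof
      fix t assume "t \<in> (\<lambda>t. \<alpha> + l * t) -` N"
      then show "t \<in> (\<lambda>y. (y - \<alpha>) / l) ` N"
        using l by (intro image_eqI[of _ _ "\<alpha> + l * t"]) (simp_all add: field_simps)
    qed
    then show "countable ((\<lambda>t. \<alpha> + l * t) -` N)"
      using N by (rule countable_subset[OF _ countable_image])
  next
    fix t :: real assume t: "t \<in> {0<..<1}" "t \<notin> (\<lambda>t. \<alpha> + l * t) -` N"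
    then have "\<alpha> + l * t \<in> {\<alpha><..<\<beta>}"
      using l mult_strict_left_mono[of t 1 l] by (auto simp: \<beta>)
    then have "(f has_real_derivative D (\<alpha> + l * t)) (at (\<alpha> + l * t))" using D t by auto
    then show "((\<lambda>t. f (\<alpha> + l * t)) has_real_derivative D (\<alpha> + l * t) * l) (at t)"
      by (rule DERIV_chain'[rotated]) (auto intro!: derivative_eq_intros)
  qed (use l L f in \<open>auto simp: \<beta>\<close>)
  also have "(\<integral>\<^sup>+ t. ennreal (\<bar>D (\<alpha> + l * t) * l\<bar> powr p) * indicator {0..1} t \<partial>lborel)
     = ennreal (l powr p) * (\<integral>\<^sup>+ t. ennreal (\<bar>D (\<alpha> + l * t)\<bar> powr p) * indicator {0..1} t \<partial>lborel)"
    using l by (subst nn_integral_cmult[symmetric])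
      (auto simp: abs_mult powr_mult ennreal_mult'' mult_ac intro!: nn_integral_cong)
  finally have "ennreal l * (\<integral>\<^sup>+ t. ennreal (\<bar>f (\<alpha> + l * t)\<bar> powr p) * indicator {0..1} t \<partial>lborel)
     \<le> ennreal l * (ennreal C * (ennreal (l powr p) *
         (\<integral>\<^sup>+ t. ennreal (\<bar>D (\<alpha> + l * t)\<bar> powr p) * indicator {0..1} t \<partial>lborel)))"
    by (rule mult_left_mono) simp
  then show ?thesis
    unfolding scale[OF assms(11)] scale[OF assms(10)] l_def[symmetric] by (simp add: mult_ac)
qed

text \<open>
  Tested on the parabola \<open>t * (1 - t)\<close>.
\<close>
lemma poincare_constant_pos:
  assumes p: "1 < p" and pc: "poincare_constant p C"
  shows "0 < C"
proof (rule ccontr)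
  assume "\<not> 0 < C"
  let ?v = "\<lambda>t::real. t * (1 - t)"
  have "(\<integral>\<^sup>+ t. ennreal (\<bar>?v t\<bar> powr p) * indicator {0..1} t \<partial>lborel)
    \<le> ennreal C * (\<integral>\<^sup>+ t. ennreal (\<bar>1 - 2 * t\<bar> powr p) * indicator {0..1} t \<partial>lborel)"
  proof (rule poincare_unit_interval[OF p pc, where L = 1 and N = "{}"])
    fix s t :: real assume "s \<in> {0..1}" "t \<in> {0..1}"
    then have "\<bar>1 - s - t\<bar> \<le> 1" by auto
    then have "\<bar>1 - s - t\<bar> * \<bar>t - s\<bar> \<le> 1 * \<bar>t - s\<bar>" by (intro mult_right_mono) auto
    moreover have "?v t - ?v s = (1 - s - t) * (t - s)" by (simp add: algebra_simps)
    ultimately show "\<bar>?v t - ?v s\<bar> \<le> 1 * \<bar>t - s\<bar>" by (simp only: abs_mult)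
  next
    fix t :: real
    show "(?v has_real_derivative 1 - 2 * t) (at t)" by (auto intro!: derivative_eq_intros)
  qed auto
  then have "(\<integral>\<^sup>+ t. ennreal (\<bar>?v t\<bar> powr p) * indicator {0..1} t \<partial>lborel) = 0"
    using \<open>\<not> 0 < C\<close> by (simp add: ennreal_neg)
  then have "AE t in lborel. ennreal (\<bar>?v t\<bar> powr p) * indicator {0..1} t = 0"
    by (subst (asm) nn_integral_0_iff_AE) auto
  then have "AE t::real in lborel. t \<notin> {0<..<1}"
    by eventually_elim (auto simp: indicator_def split: if_splits)
  then have "{0<..<1::real} \<in> null_sets lborel"
    by (subst (asm) AE_iff_null_sets[symmetric]) auto
  then show False by (simp add: null_sets_def)
qed


section \<open>The weighted Poincare inequality on the domain\<close>

lemma frontier_if_leaves: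
  fixes z h :: "'a::real_normed_vector"
  assumes z: "z \<in> S" and out: "\<And>e. 0 < e \<Longrightarrow> z + e *\<^sub>R h \<notin> S"
  shows "z \<in> frontier S"
proof -
  have "z \<notin> interior S"
  proof
    assume "z \<in> interior S"
    moreover have "((\<lambda>e. z + e *\<^sub>R h) \<longlongrightarrow> z + 0 *\<^sub>R h) (at_right 0)"
      by (intro tendsto_intros)
    ultimately have "\<forall>\<^sub>F e in at_right 0. z + e *\<^sub>R h \<in> interior S"
      by (auto elim: topological_tendstoD)
    then have "\<forall>\<^sub>F e in at_right (0::real). False"
      using eventually_at_right_less[of 0]
      by eventually_elim (use out interior_subset in blast)
    then show False by simp
  qed
  then show ?thesis using z closure_subset by (auto simp: frontier_def)
qed

text \<open>
  A sequential limit of difference quotients: it agrees with \<open>partial_y\<close> wherever the latter is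
  meaningful, and is Borel measurable as a function of the point.
\<close>
definition vertical_derivative :: "(real \<times> real \<Rightarrow> real) \<Rightarrow> real \<times> real \<Rightarrow> real" where
  "vertical_derivative f z = lim (\<lambda>n. real (Suc n) * (f (fst z, snd z + 1 / real (Suc n)) - f z))"

lemma borel_measurable_vertical_derivative:
  assumes f: "f \<in> borel_measurable borel"
  shows "vertical_derivative f \<in> borel_measurable borel"
proof -
  have [measurable]: "f \<in> borel_measurable (borel \<Otimes>\<^sub>M borel)"
    using f by (simp add: borel_prod)
  have "vertical_derivative f \<in> borel_measurable (borel \<Otimes>\<^sub>M borel)"
    unfolding vertical_derivative_def by measurable
  then show ?thesis by (simp add: borel_prod)
qed

lemma vertical_derivative_eq:
  assumes "((\<lambda>t. f (x, t)) has_real_derivative d) (at y)"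
  shows "vertical_derivative f (x, y) = d"
  using has_real_derivative_imp_LIMSEQ[OF assms, of 1] unfolding vertical_derivative_def
  by (auto intro: limI)

lemma AE_vertical_derivative:
  assumes dom: "convex_compact_domain \<Omega>" and u: "u \<in> admissible \<Omega>"
  shows "AE z in lborel. z \<in> \<Omega> \<longrightarrow> z \<in> interior \<Omega> \<and> gradient_defined u z \<and>
      partial_y u z = vertical_derivative (zero_extension \<Omega> u) z"
proof -
  have \<Omega>: "compact \<Omega>" "convex \<Omega>" using dom by (auto simp: convex_compact_domain_def)
  have "frontier \<Omega> \<in> null_sets lborel"
    using negligible_convex_frontier[OF \<Omega>(2)] by (simp add: negligible_iff_null_sets null_sets_completion_iff)
  then have "AE z in lborel. z \<notin> frontier \<Omega>" by (rule AE_not_in)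
  moreover have "AE z in lborel. z \<in> interior \<Omega> \<longrightarrow> gradient_defined u z"
    using u \<Omega> by (intro AE_gradient_defined) (auto simp: admissible_def)
  ultimately show ?thesis
  proof eventually_elim
    case (elim z)
    show ?case
    proof
      assume "z \<in> \<Omega>"
      then have z: "z \<in> interior \<Omega>" using elim closure_subset by (auto simp: frontier_def)
      then have g: "gradient_defined u z" using elim by auto
      have "((\<lambda>t. u (fst z, t)) has_real_derivative partial_y u z) (at (snd z))"
        using g by (simp add: gradient_defined_def partial_y_def DERIV_deriv_iff_real_differentiable)
      then have "((\<lambda>t. zero_extension \<Omega> u (fst z, t)) has_real_derivative partial_y u z) (at (snd z))"
        by (rule has_field_derivative_transform_within_open[OF _ open_slices(1)[OF open_interior, of "fst z" \<Omega>]])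
          (use z interior_subset[of \<Omega>] in \<open>auto simp: zero_extension_def\<close>)
      then have "vertical_derivative (zero_extension \<Omega> u) z = partial_y u z"
        using vertical_derivative_eq by fastforce
      with z g show "z \<in> interior \<Omega> \<and> gradient_defined u z \<and>
          partial_y u z = vertical_derivative (zero_extension \<Omega> u) z" by simp
    qed
  qed
qed

text \<open>
  The endpoints of a vertical slice lie on the frontier of \<open>\<Omega>\<close>, so \<open>u\<close> vanishes there. Slices that
  are empty or a single point are null sets.
\<close>
lemma poincare_vertical_slice:
  fixes u :: "real \<times> real \<Rightarrow> real" and \<Omega> :: "(real \<times> real) set"
  defines "U \<equiv> zero_extension \<Omega> u"
  assumes p: "1 < p" and pc: "poincare_constant p C"
    and dom: "convex_compact_domain \<Omega>" and u: "u \<in> admissible \<Omega>"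
    and diam: "\<And>y y'. (x, y) \<in> \<Omega> \<Longrightarrow> (x, y') \<in> \<Omega> \<Longrightarrow> \<bar>y' - y\<bar> \<le> l"
  shows "(\<integral>\<^sup>+ y. ennreal (\<bar>U (x, y)\<bar> powr p) \<partial>lborel) \<le> ennreal C * ennreal (l powr p) *
     (\<integral>\<^sup>+ y. ennreal (\<bar>vertical_derivative U (x, y)\<bar> powr p) * indicator \<Omega> (x, y) \<partial>lborel)"
proof -
  let ?S = "{y. (x, y) \<in> \<Omega>}"
  have \<Omega>: "compact \<Omega>" "convex \<Omega>" using dom by (auto simp: convex_compact_domain_def)
  have cont: "continuous_on \<Omega> u" and conc: "concave_on \<Omega> u" and zero: "\<And>z. z \<in> frontier \<Omega> \<Longrightarrow> u z = 0"
    using u by (auto simp: admissible_def)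
  have U: "U \<in> borel_measurable borel"
    unfolding U_def using cont \<Omega> by (intro borel_measurable_zero_extension borel_compact)
  then have [measurable]: "U \<in> borel_measurable (borel \<Otimes>\<^sub>M borel)"
    "vertical_derivative U \<in> borel_measurable (borel \<Otimes>\<^sub>M borel)"
    using borel_measurable_vertical_derivative[OF U] by (simp_all add: borel_prod)
  have slice: "convex_on ?S (\<lambda>y. - u (x, y))"
    using convex_on_slices(1)[of \<Omega> "\<lambda>z. - u z"] conc by (simp add: concave_on_def)
  then have "connected ?S" using convex_on_imp_convex convex_connected by blast
  then obtain \<alpha> \<beta> where S: "?S = {\<alpha>..\<beta>}"
    using compact_vertical_slice[OF \<Omega>(1), of x] connected_compact_interval_1[of ?S] by blast
  have iff: "(x, y) \<in> \<Omega> \<longleftrightarrow> y \<in> {\<alpha>..\<beta>}" for y using S by auto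
  have out: "U (x, y) = 0" if "y \<notin> {\<alpha>..\<beta>}" for y
    using that iff by (auto simp: U_def zero_extension_def)
  have ext: "U (x, y) = u (x, y)" if "y \<in> {\<alpha>..\<beta>}" for y
    using that iff by (auto simp: U_def zero_extension_def)
  show ?thesis
  proof (cases "\<alpha> < \<beta>")
    case False
    have "AE y in lborel. ennreal (\<bar>U (x, y)\<bar> powr p) = 0"
      using AE_lborel_singleton[of \<alpha>] by eventually_elim (use False out in auto)
    then have "(\<integral>\<^sup>+ y. ennreal (\<bar>U (x, y)\<bar> powr p) \<partial>lborel) = (\<integral>\<^sup>+ y. 0 \<partial>(lborel :: real measure))"
      by (rule nn_integral_cong_AE)
    then show ?thesis by simp
  next
    case True
    have "(x, \<alpha>) \<in> frontier \<Omega>"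
      by (rule frontier_if_leaves[of _ _ "(0, -1)"]) (use True in \<open>auto simp: iff\<close>)
    moreover have "(x, \<beta>) \<in> frontier \<Omega>"
      by (rule frontier_if_leaves[of _ _ "(0, 1)"]) (use True in \<open>auto simp: iff\<close>)
    ultimately have ends: "U (x, \<alpha>) = 0" "U (x, \<beta>) = 0" using zero ext True by auto
    obtain B where B: "0 \<le> B" "\<And>z w. z \<in> \<Omega> \<Longrightarrow> w \<in> \<Omega> \<Longrightarrow> \<bar>u w - u z\<bar> \<le> B * dist w z"
      using admissible_lipschitz[OF dom u] by blast
    let ?N = "{y \<in> {\<alpha><..<\<beta>}. \<not> (\<lambda>y. - U (x, y)) differentiable (at y)}"
    have "convex_on {\<alpha><..<\<beta>} (\<lambda>y. - u (x, y))"
      by (rule convex_on_subset[OF slice]) (auto simp: iff)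
    then have "convex_on {\<alpha><..<\<beta>} (\<lambda>y. - U (x, y))"
      using convexD[of "{\<alpha><..<\<beta>}"] by (simp add: convex_on_def ext less_imp_le)
    then have N: "countable ?N" by (rule convex_on_countable_nondifferentiable) simp
    have "(\<integral>\<^sup>+ y. ennreal (\<bar>U (x, y)\<bar> powr p) * indicator {\<alpha>..\<beta>} y \<partial>lborel)
      \<le> ennreal C * ennreal ((\<beta> - \<alpha>) powr p) *
        (\<integral>\<^sup>+ y. ennreal (\<bar>vertical_derivative U (x, y)\<bar> powr p) * indicator {\<alpha>..\<beta>} y \<partial>lborel)"
    proof (rule poincare_interval[OF p pc True _ B(1) ends N])
      fix s t assume st: "s \<in> {\<alpha>..\<beta>}" "t \<in> {\<alpha>..\<beta>}"
      then show "\<bar>U (x, t) - U (x, s)\<bar> \<le> B * \<bar>t - s\<bar>"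
        using B(2)[of "(x, s)" "(x, t)"] by (simp add: ext iff dist_Pair_Pair dist_real_def)
    next
      fix y assume "y \<in> {\<alpha><..<\<beta>}" "y \<notin> ?N"
      then have "(\<lambda>y. - U (x, y)) differentiable (at y)" by blast
      then have "(\<lambda>y. - (- U (x, y))) differentiable (at y)" by (rule differentiable_minus)
      then obtain d where "((\<lambda>y. U (x, y)) has_real_derivative d) (at y)"
        by (auto simp: real_differentiable_def)
      then show "((\<lambda>y. U (x, y)) has_real_derivative vertical_derivative U (x, y)) (at y)"
        using vertical_derivative_eq by metis
    qed measurable
    moreover have "\<beta> - \<alpha> \<le> l" using diam[of \<alpha> \<beta>] True by (simp add: iff)
    then have "(\<beta> - \<alpha>) powr p \<le> l powr p" using True p by (intro powr_mono2) auto
    then have "ennreal C * ennreal ((\<beta> - \<alpha>) powr p) *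
        (\<integral>\<^sup>+ y. ennreal (\<bar>vertical_derivative U (x, y)\<bar> powr p) * indicator {\<alpha>..\<beta>} y \<partial>lborel)
      \<le> ennreal C * ennreal (l powr p) *
        (\<integral>\<^sup>+ y. ennreal (\<bar>vertical_derivative U (x, y)\<bar> powr p) * indicator {\<alpha>..\<beta>} y \<partial>lborel)"
      by (intro mult_right_mono mult_left_mono ennreal_leI) auto
    moreover have "ennreal (\<bar>U (x, y)\<bar> powr p) = ennreal (\<bar>U (x, y)\<bar> powr p) * indicator {\<alpha>..\<beta>} y" for y
      using out[of y] by (auto simp: indicator_def)
    moreover have "indicator \<Omega> (x, y) = (indicator {\<alpha>..\<beta>} y :: ennreal)" for y
      using iff[of y] by (auto simp: indicator_def)
    ultimately show ?thesis by simp
  qed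
qed

text \<open>
  The length of the slice over \<open>x\<close> is at most \<open>M * d x\<close>, so its \<open>p\<close>-th power, which appears
  when the Poincare inequality is rescaled to the slice, cancels the weight up to \<open>M powr p\<close>.
\<close>
lemma weighted_poincare:
  fixes u :: "real \<times> real \<Rightarrow> real" and \<Omega> :: "(real \<times> real) set"
  defines "U \<equiv> zero_extension \<Omega> u"
  assumes p: "1 < p" and pc: "poincare_constant p C"
    and dom: "convex_compact_domain \<Omega>" and u: "u \<in> admissible \<Omega>"
    and d: "\<And>z. z \<in> \<Omega> \<Longrightarrow> 0 \<le> d (fst z)" and [measurable]: "d \<in> borel_measurable borel"
    and M: "0 \<le> M"
    and diam: "\<And>x y y'. (x, y) \<in> \<Omega> \<Longrightarrow> (x, y') \<in> \<Omega> \<Longrightarrow> \<bar>y' - y\<bar> \<le> M * d x"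
  shows "(\<integral>\<^sup>+ z. ennreal ((\<bar>U z\<bar> / d (fst z)) powr p) \<partial>lborel) \<le> ennreal C * ennreal (M powr p) *
     (\<integral>\<^sup>+ z. ennreal (\<bar>vertical_derivative U z\<bar> powr p) * indicator \<Omega> z \<partial>lborel)"
proof -
  let ?V = "vertical_derivative U"
  have \<Omega>: "compact \<Omega>" "convex \<Omega>" using dom by (auto simp: convex_compact_domain_def)
  have cont: "continuous_on \<Omega> u" using u by (auto simp: admissible_def)
  have U: "U \<in> borel_measurable borel"
    unfolding U_def using cont \<Omega> by (intro borel_measurable_zero_extension borel_compact)
  then have [measurable]: "U \<in> borel_measurable (borel \<Otimes>\<^sub>M borel)"
    "?V \<in> borel_measurable (borel \<Otimes>\<^sub>M borel)"
    using borel_measurable_vertical_derivative[OF U] by (simp_all add: borel_prod)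
  have [measurable]: "\<Omega> \<in> sets (borel \<Otimes>\<^sub>M borel)"
    unfolding borel_prod using \<Omega>(1) by (rule borel_compact)
  have slice: "(\<integral>\<^sup>+ y. ennreal ((\<bar>U (x, y)\<bar> / d x) powr p) \<partial>lborel)
      \<le> ennreal C * ennreal (M powr p) * (\<integral>\<^sup>+ y. ennreal (\<bar>?V (x, y)\<bar> powr p) * indicator \<Omega> (x, y) \<partial>lborel)"
    for x
  proof (cases "0 < d x")
    case False
    \<comment> \<open>For negative d x the slice is empty; for d x = 0 the quotient is 0, as x / 0 = 0.\<close>
    have "\<bar>U (x, y)\<bar> / d x = 0" for y
      using d[of "(x, y)"] False by (cases "d x = 0") (auto simp: U_def zero_extension_def)
    then have "(\<lambda>y. ennreal ((\<bar>U (x, y)\<bar> / d x) powr p)) = (\<lambda>y. 0)"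
      by (simp only: powr_0 ennreal_0)
    then show ?thesis by simp
  next
    case True
    have "(\<integral>\<^sup>+ y. ennreal ((\<bar>U (x, y)\<bar> / d x) powr p) \<partial>lborel)
        = ennreal (1 / d x powr p) * (\<integral>\<^sup>+ y. ennreal (\<bar>U (x, y)\<bar> powr p) \<partial>lborel)"
      using True by (subst nn_integral_cmult[symmetric])
        (auto simp: powr_divide simp flip: ennreal_mult intro!: nn_integral_cong)
    also have "\<dots> \<le> ennreal (1 / d x powr p) * (ennreal C * ennreal ((M * d x) powr p) *
        (\<integral>\<^sup>+ y. ennreal (\<bar>?V (x, y)\<bar> powr p) * indicator \<Omega> (x, y) \<partial>lborel))"
      unfolding U_def
      by (intro mult_left_mono poincare_vertical_slice[OF p pc dom u] diam) auto
    also have "\<dots> = ennreal C * (ennreal (1 / d x powr p) * ennreal ((M * d x) powr p)) *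
        (\<integral>\<^sup>+ y. ennreal (\<bar>?V (x, y)\<bar> powr p) * indicator \<Omega> (x, y) \<partial>lborel)"
      by (simp add: mult_ac)
    also have "ennreal (1 / d x powr p) * ennreal ((M * d x) powr p) = ennreal (M powr p)"
      using True M by (simp add: powr_mult flip: ennreal_mult)
    finally show ?thesis .
  qed
  have "(\<integral>\<^sup>+ z. ennreal ((\<bar>U z\<bar> / d (fst z)) powr p) \<partial>(lborel \<Otimes>\<^sub>M lborel))
      = (\<integral>\<^sup>+ x. \<integral>\<^sup>+ y. ennreal ((\<bar>U (x, y)\<bar> / d x) powr p) \<partial>lborel \<partial>lborel)"
    by (subst lborel.nn_integral_fst[symmetric]) auto
  also have "\<dots> \<le> (\<integral>\<^sup>+ x. ennreal C * ennreal (M powr p) *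
      (\<integral>\<^sup>+ y. ennreal (\<bar>?V (x, y)\<bar> powr p) * indicator \<Omega> (x, y) \<partial>lborel) \<partial>lborel)"
    by (intro nn_integral_mono slice)
  also have "\<dots> = ennreal C * ennreal (M powr p) *
      (\<integral>\<^sup>+ x. \<integral>\<^sup>+ y. ennreal (\<bar>?V (x, y)\<bar> powr p) * indicator \<Omega> (x, y) \<partial>lborel \<partial>lborel)"
    by (rule nn_integral_cmult) measurable
  also have "(\<integral>\<^sup>+ x. \<integral>\<^sup>+ y. ennreal (\<bar>?V (x, y)\<bar> powr p) * indicator \<Omega> (x, y) \<partial>lborel \<partial>lborel)
      = (\<integral>\<^sup>+ z. ennreal (\<bar>?V z\<bar> powr p) * indicator \<Omega> z \<partial>(lborel \<Otimes>\<^sub>M lborel))"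
    by (subst lborel.nn_integral_fst[symmetric]) auto
  finally show ?thesis by (simp add: lborel_prod)
qed


section \<open>The bound on the quotient of the norms\<close>

text \<open>
  The tangent plane at \<open>z\<close> is nonnegative at \<open>P\<close> and at \<open>Q\<close>, where \<open>u\<close> vanishes. In terms of the derivative
  \<open>g\<close> along the chord \<open>PQ\<close> this gives an upper and a lower bound for \<open>g\<close>.
\<close>
lemma partial_x_bound:
  fixes u :: "real \<times> real \<Rightarrow> real"
  assumes dom: "convex_compact_domain \<Omega>" and u: "u \<in> admissible \<Omega>"
    and PQ: "P \<in> \<Omega>" "Q \<in> \<Omega>" "fst P < fst Q"
    and strip: "\<And>z. z \<in> \<Omega> \<Longrightarrow> fst P \<le> fst z \<and> fst z \<le> fst Q"
    and cone: "\<And>z. z \<in> \<Omega> \<Longrightarrow> \<bar>snd z - snd P - k * (fst z - fst P)\<bar> \<le> \<mu> * min (fst z - fst P) (fst Q - fst z)"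
    and k: "k = (snd Q - snd P) / (fst Q - fst P)"
    and z: "z \<in> interior \<Omega>" "gradient_defined u z"
  shows "\<bar>partial_x u z\<bar> \<le> \<bar>u z\<bar> / min (fst z - fst P) (fst Q - fst z) + (\<mu> + \<bar>k\<bar>) * \<bar>partial_y u z\<bar>"
proof -
  have conc: "concave_on \<Omega> u" and zero: "\<And>z. z \<in> frontier \<Omega> \<Longrightarrow> u z = 0"
    using u by (auto simp: admissible_def)
  have left: "w \<in> frontier \<Omega>" if "w \<in> \<Omega>" "fst w = fst P" for w
    by (rule frontier_if_leaves[OF that(1), of "(-1, 0)"]) (use strip that in fastforce)
  have right: "w \<in> frontier \<Omega>" if "w \<in> \<Omega>" "fst w = fst Q" for w
    by (rule frontier_if_leaves[OF that(1), of "(1, 0)"]) (use strip that in fastforce)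
  have z\<Omega>: "z \<in> \<Omega>" "z \<notin> frontier \<Omega>" using z interior_subset by (auto simp: frontier_def)
  define s r where "s = fst z - fst P" and "r = fst Q - fst z"
  define y where "y = snd z - snd P - k * s"
  define g where "g = partial_x u z + k * partial_y u z"
  have "fst z \<noteq> fst P" "fst z \<noteq> fst Q" using left[of z] right[of z] z\<Omega> by blast+
  with strip[OF z\<Omega>(1)] have sr: "0 < s" "0 < r" by (auto simp: s_def r_def)
  have y: "\<bar>y\<bar> \<le> \<mu> * min s r" using cone[OF z\<Omega>(1)] by (simp add: y_def s_def r_def)
  have "k * (s + r) = snd Q - snd P" using PQ(3) by (simp add: s_def r_def k)
  then have Qy: "snd Q - snd z = k * r - y" by (simp add: y_def distrib_left)
  \<comment> \<open>T times the smaller distance bounds what the tangent plane leaves at P and at Q.\<close>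
  define T where "T = \<bar>u z\<bar> / min s r + \<mu> * \<bar>partial_y u z\<bar>"
  have "\<mu> \<ge> 0" using y sr by (smt (verit) mult_neg_pos min_less_iff_conj)
  then have T: "0 \<le> T" using sr by (simp add: T_def)
  have "\<bar>u z\<bar> + \<bar>partial_y u z\<bar> * \<bar>y\<bar> \<le> \<bar>u z\<bar> + \<bar>partial_y u z\<bar> * (\<mu> * min s r)"
    using y by (intro add_left_mono mult_left_mono) auto
  also have "\<dots> = T * min s r"
    using sr by (simp add: T_def distrib_right)
  finally have b: "\<bar>u z\<bar> + \<bar>partial_y u z\<bar> * \<bar>y\<bar> \<le> T * min s r" .
  have ab: "u z - partial_y u z * y \<le> \<bar>u z\<bar> + \<bar>partial_y u z\<bar> * \<bar>y\<bar>"
    by (metis abs_ge_self abs_minus_cancel abs_mult add_mono diff_conv_add_uminus)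
  have "u P \<le> u z + partial_x u z * (fst P - fst z) + partial_y u z * (snd P - snd z)"
    by (rule concave_on_le_tangent_plane[OF conc z PQ(1)])
  also have "snd P - snd z = - (y + k * s)" by (simp add: y_def)
  also have "fst P - fst z = - s" by (simp add: s_def)
  finally have "g * s \<le> u z - partial_y u z * y"
    using zero[OF left[OF PQ(1)]] by (simp add: g_def algebra_simps)
  also have "\<dots> \<le> T * min s r" using ab b by linarith
  also have "\<dots> \<le> T * s" using T by (intro mult_left_mono) auto
  finally have 1: "g \<le> T" using sr by simp
  have "u Q \<le> u z + partial_x u z * (fst Q - fst z) + partial_y u z * (snd Q - snd z)"
    by (rule concave_on_le_tangent_plane[OF conc z PQ(2)])
  also have "fst Q - fst z = r" by (simp add: r_def)
  finally have "- g * r \<le> u z - partial_y u z * y"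
    using zero[OF right[OF PQ(2)]] unfolding Qy by (simp add: g_def algebra_simps)
  also have "\<dots> \<le> T * min s r" using ab b by linarith
  also have "\<dots> \<le> T * r" using T by (intro mult_left_mono) auto
  finally have 2: "- g \<le> T" using sr mult_le_cancel_right_pos[of r "- g" T] by simp
  have "\<bar>partial_x u z\<bar> \<le> \<bar>g\<bar> + \<bar>k * partial_y u z\<bar>" by (simp add: g_def)
  also have "\<dots> \<le> T + \<bar>k\<bar> * \<bar>partial_y u z\<bar>" using 1 2 by (simp add: abs_mult)
  finally show ?thesis unfolding T_def s_def r_def by (simp add: algebra_simps)
qed

text \<open>
  This is convexity of the \<open>p\<close>-th power at \<open>(a + b) / (\<alpha> + \<kappa>)\<close>, a convex combination of \<open>a / \<alpha>\<close> and
  \<open>b / \<kappa>\<close>. With \<open>\<alpha>\<close> and \<open>\<kappa>\<close> chosen as bounds for the two norms, integrating it yields Minkowski's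
  inequality.
\<close>
lemma powr_convex_sum:
  fixes a b :: real
  assumes p: "1 < p" and ab: "0 \<le> a" "0 \<le> b" and k: "0 < \<alpha>" "0 < \<kappa>"
  shows "(a + b) powr p \<le> (\<alpha> + \<kappa>) powr p *
     (\<alpha> / (\<alpha> + \<kappa>) * (a / \<alpha>) powr p + \<kappa> / (\<alpha> + \<kappa>) * (b / \<kappa>) powr p)"
proof -
  let ?S = "\<alpha> + \<kappa>"
  have conv: "((1 - t) * x + t * y) powr p \<le> (1 - t) * x powr p + t * y powr p"
    if "0 < x" "0 < y" "0 \<le> t" "t \<le> 1" for x y t :: real
    using convex_onD[OF powr_convex[of p], of t x y] p that by simp
  have le: "t powr p \<le> t" if "0 \<le> t" "t \<le> 1" for t :: real
    using powr_mono'[of 1 p t] p that by simp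
  have one: "(t * x) powr p \<le> t * x powr p" if "0 \<le> x" "0 \<le> t" "t \<le> 1" for x t :: real
    using that mult_right_mono[OF le, of t "x powr p"] by (simp add: powr_mult)
  have gen: "((1 - t) * x + t * y) powr p \<le> (1 - t) * x powr p + t * y powr p"
    if t: "0 \<le> t" "t \<le> 1" and "0 \<le> x" "0 \<le> y" for x y t :: real
    using conv[of x y t] one[of y t] one[of x "1 - t"] that
    by (cases "x = 0"; cases "y = 0") auto
  let ?t = "\<kappa> / ?S"
  have t: "1 - ?t = \<alpha> / ?S" using k by (simp add: field_simps)
  have "(1 - ?t) * (a / \<alpha>) + ?t * (b / \<kappa>) = (a + b) / ?S"
    unfolding t using k by (simp add: add_divide_distrib)
  then have "((a + b) / ?S) powr p \<le> \<alpha> / ?S * (a / \<alpha>) powr p + ?t * (b / \<kappa>) powr p"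
    using gen[of ?t "a / \<alpha>" "b / \<kappa>"] ab k unfolding t by simp
  then have "?S powr p * ((a + b) / ?S) powr p
      \<le> ?S powr p * (\<alpha> / ?S * (a / \<alpha>) powr p + ?t * (b / \<kappa>) powr p)"
    by (rule mult_left_mono) simp
  moreover have "?S powr p * ((a + b) / ?S) powr p = (a + b) powr p"
    using ab k by (simp flip: powr_mult)
  ultimately show ?thesis by simp
qed

text \<open>
  The two terms of the pointwise bound have norms at most \<open>\<alpha>\<close> and \<open>\<kappa>\<close> times the norm of \<open>u_y\<close>, the
  first by the weighted Poincare inequality; \<open>S\<close> is \<open>\<alpha> + \<kappa>\<close>.
\<close>
lemma nn_integral_partial_x_le:
  fixes u :: "real \<times> real \<Rightarrow> real" and \<Omega> :: "(real \<times> real) set"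
  defines "V \<equiv> vertical_derivative (zero_extension \<Omega> u)"
  assumes p: "1 < p" and pc: "poincare_constant p C"
    and dom: "convex_compact_domain \<Omega>" and u: "u \<in> admissible \<Omega>"
    and PQ: "P \<in> \<Omega>" "Q \<in> \<Omega>" "fst P < fst Q"
    and strip: "\<And>z. z \<in> \<Omega> \<Longrightarrow> fst P \<le> fst z \<and> fst z \<le> fst Q"
    and cone: "\<And>z. z \<in> \<Omega> \<Longrightarrow> \<bar>snd z - snd P - k * (fst z - fst P)\<bar> \<le> \<mu> * min (fst z - fst P) (fst Q - fst z)"
    and k: "k = (snd Q - snd P) / (fst Q - fst P)" and \<mu>: "0 < \<mu>"
    and S: "S = \<mu> * (2 * C powr (1 / p) + 1) + \<bar>k\<bar>"
    and ae: "AE z in lborel. z \<in> \<Omega> \<longrightarrow> z \<in> interior \<Omega> \<and> gradient_defined u z \<and> partial_y u z = V z"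
  shows "(\<integral>\<^sup>+ z. ennreal (\<bar>partial_x u z\<bar> powr p) * indicator \<Omega> z \<partial>lborel)
    \<le> ennreal (S powr p) * (\<integral>\<^sup>+ z. ennreal (\<bar>V z\<bar> powr p) * indicator \<Omega> z \<partial>lborel)"
proof -
  let ?U = "zero_extension \<Omega> u"
  let ?J = "\<integral>\<^sup>+ z. ennreal (\<bar>V z\<bar> powr p) * indicator \<Omega> z \<partial>lborel"
  have \<Omega>: "compact \<Omega>" using dom by (auto simp: convex_compact_domain_def)
  have [measurable]: "\<Omega> \<in> sets borel" using \<Omega> by (rule borel_compact)
  have [measurable]: "?U \<in> borel_measurable borel"
    using u \<Omega> by (intro borel_measurable_zero_extension borel_compact) (auto simp: admissible_def)
  have [measurable]: "V \<in> borel_measurable borel"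
    unfolding V_def by (rule borel_measurable_vertical_derivative) measurable
  define d where "d x = min (x - fst P) (fst Q - x)" for x
  have [measurable]: "d \<in> borel_measurable borel" unfolding d_def by measurable
  have [measurable]: "(\<lambda>z::real \<times> real. d (fst z)) \<in> borel_measurable borel"
    unfolding d_def by (intro borel_measurable_continuous_onI continuous_intros)
  have C: "0 < C" using p pc by (rule poincare_constant_pos)
  define \<alpha> \<kappa> where "\<alpha> = 2 * \<mu> * C powr (1 / p)" and "\<kappa> = \<mu> + \<bar>k\<bar>"
  have pos: "0 < \<alpha>" "0 < \<kappa>" using \<mu> C by (auto simp: \<alpha>_def \<kappa>_def)
  have S': "S = \<alpha> + \<kappa>" by (simp add: S \<alpha>_def \<kappa>_def algebra_simps)
  have \<alpha>p: "\<alpha> powr p = C * (2 * \<mu>) powr p"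
    using \<mu> C p by (simp add: \<alpha>_def powr_mult powr_powr)
  define A B where "A z = (\<bar>?U z\<bar> / d (fst z)) powr p" and "B z = \<bar>V z\<bar> powr p" for z
  \<comment> \<open>The coefficients of A and B that convexity yields; a times the p-th power of \<alpha>, plus b, is the p-th power of S.\<close>
  define a b where "a = S powr p * (\<alpha> / S) / \<alpha> powr p" and "b = S powr p * (\<kappa> / S)"
  have ab: "0 \<le> a" "0 \<le> b" using pos by (auto simp: a_def b_def S')
  have d: "0 \<le> d (fst z)" if "z \<in> \<Omega>" for z using strip[OF that] by (simp add: d_def)
  have "(\<integral>\<^sup>+ z. ennreal (\<bar>partial_x u z\<bar> powr p) * indicator \<Omega> z \<partial>lborel)
      \<le> (\<integral>\<^sup>+ z. ennreal a * ennreal (A z) + ennreal b * (ennreal (B z) * indicator \<Omega> z) \<partial>lborel)"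
  proof (rule nn_integral_mono_AE)
    show "AE z in lborel. ennreal (\<bar>partial_x u z\<bar> powr p) * indicator \<Omega> z
        \<le> ennreal a * ennreal (A z) + ennreal b * (ennreal (B z) * indicator \<Omega> z)"
      using ae
    proof eventually_elim
      case (elim z)
      show ?case
      proof (cases "z \<in> \<Omega>")
        case True
        then have z: "z \<in> interior \<Omega>" "gradient_defined u z" "partial_y u z = V z" using elim by auto
        have Uz: "?U z = u z" using True by (simp add: zero_extension_def)
        have "\<bar>partial_x u z\<bar> \<le> \<bar>?U z\<bar> / d (fst z) + \<kappa> * \<bar>V z\<bar>"
          using partial_x_bound[OF dom u PQ strip cone k z(1,2)] by (simp add: d_def \<kappa>_def Uz z(3))
        then have "\<bar>partial_x u z\<bar> powr p \<le> (\<bar>?U z\<bar> / d (fst z) + \<kappa> * \<bar>V z\<bar>) powr p"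
          using p by (intro powr_mono2) auto
        also have "\<dots> \<le> (\<alpha> + \<kappa>) powr p * (\<alpha> / (\<alpha> + \<kappa>) * (\<bar>?U z\<bar> / d (fst z) / \<alpha>) powr p
            + \<kappa> / (\<alpha> + \<kappa>) * (\<kappa> * \<bar>V z\<bar> / \<kappa>) powr p)"
          using pos d[OF True] by (intro powr_convex_sum p) auto
        also have "\<dots> = a * A z + b * B z"
          using pos d[OF True] by (simp add: a_def b_def A_def B_def S' powr_divide powr_mult distrib_left mult_ac)
        finally have "ennreal (\<bar>partial_x u z\<bar> powr p) \<le> ennreal (a * A z + b * B z)"
          by (rule ennreal_leI)
        then show ?thesis using True ab by (simp add: A_def B_def ennreal_mult)
      qed simp
    qed
  qed
  also have "\<dots> = ennreal a * (\<integral>\<^sup>+ z. ennreal (A z) \<partial>lborel) + ennreal b * ?J"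
    unfolding A_def B_def by (subst nn_integral_add) (auto simp: nn_integral_cmult)
  also have "\<dots> \<le> ennreal a * (ennreal C * ennreal ((2 * \<mu>) powr p) * ?J) + ennreal b * ?J"
    unfolding A_def V_def
  proof (intro add_right_mono mult_left_mono weighted_poincare[OF p pc dom u])
    fix x y y' assume "(x, y) \<in> \<Omega>" "(x, y') \<in> \<Omega>"
    then show "\<bar>y' - y\<bar> \<le> 2 * \<mu> * d x"
      using cone[of "(x, y)"] cone[of "(x, y')"] by (simp add: d_def)
  qed (use d \<mu> in auto)
  also have "\<dots> = (ennreal a * ennreal (\<alpha> powr p) + ennreal b) * ?J"
    using C by (simp add: \<alpha>p ennreal_mult distrib_left distrib_right mult_ac)
  also have "ennreal a * ennreal (\<alpha> powr p) + ennreal b = ennreal (a * \<alpha> powr p + b)"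
    using ab by (simp add: ennreal_mult)
  also have "a * \<alpha> powr p + b = S powr p"
  proof -
    have "a * \<alpha> powr p + b = S powr p * (\<alpha> / S + \<kappa> / S)"
      using pos by (simp add: a_def b_def distrib_left)
    also have "\<alpha> / S + \<kappa> / S = 1"
      using pos by (simp add: S' flip: add_divide_distrib)
    finally show ?thesis by simp
  qed
  finally show ?thesis .
qed

lemma Lp_norm_eq_0:
  assumes "\<not> set_integrable lebesgue \<Omega> (\<lambda>z. \<bar>f z\<bar> powr p)"
  shows "Lp_norm p \<Omega> f = 0"
  using assms by (simp add: Lp_norm_def set_lebesgue_integral_def set_integrable_def not_integrable_integral_eq)

text \<open>
  If one of the two integrals diverges, the corresponding \<open>Lp_norm\<close> is 0 by convention; then the
  quotient is 0, and the claimed bound is nonnegative.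
\<close>
lemma K_const_le:
  assumes p: "1 < p" and pc: "poincare_constant p C" and dom: "convex_compact_domain \<Omega>"
    and PQ: "P \<in> \<Omega>" "Q \<in> \<Omega>" "fst P < fst Q"
    and strip: "\<And>z. z \<in> \<Omega> \<Longrightarrow> fst P \<le> fst z \<and> fst z \<le> fst Q"
    and cone: "\<And>z. z \<in> \<Omega> \<Longrightarrow> \<bar>snd z - snd P - k * (fst z - fst P)\<bar> \<le> \<mu> * min (fst z - fst P) (fst Q - fst z)"
    and k: "k = (snd Q - snd P) / (fst Q - fst P)"
  shows "K_const p \<Omega> \<le> ereal (\<mu> * (2 * C powr (1 / p) + 1) + \<bar>k\<bar>)"
proof -
  define S where "S = \<mu> * (2 * C powr (1 / p) + 1) + \<bar>k\<bar>"
  \<comment> \<open>A vertical segment inside the domain does not fit into a degenerate cone.\<close>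
  have \<mu>: "0 < \<mu>"
  proof -
    obtain z e where ze: "e > 0" "ball z e \<subseteq> \<Omega>"
      using dom by (auto simp: convex_compact_domain_def mem_interior)
    have "z \<in> ball z e" "z + (0, e/2) \<in> ball z e"
      using ze(1) by (auto simp: dist_norm norm_Pair)
    then have in\<Omega>: "z \<in> \<Omega>" "z + (0, e/2) \<in> \<Omega>" using ze(2) by auto
    have "0 < \<mu> * min (fst z - fst P) (fst Q - fst z)"
      using cone[OF in\<Omega>(1)] cone[OF in\<Omega>(2)] ze(1) by (simp add: abs_le_iff)
    moreover have "0 \<le> min (fst z - fst P) (fst Q - fst z)" using strip[OF in\<Omega>(1)] by simp
    ultimately show ?thesis by (simp add: zero_less_mult_iff)
  qed
  then have S0: "0 \<le> S" by (auto simp: S_def intro!: add_nonneg_nonneg mult_nonneg_nonneg)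
  have "Lp_norm p \<Omega> (partial_x u) / Lp_norm p \<Omega> (partial_y u) \<le> S" if u: "u \<in> admissible \<Omega>" for u
  proof (cases "set_integrable lebesgue \<Omega> (\<lambda>z. \<bar>partial_x u z\<bar> powr p) \<and>
      set_integrable lebesgue \<Omega> (\<lambda>z. \<bar>partial_y u z\<bar> powr p)")
    case False
    then show ?thesis using S0 Lp_norm_eq_0[of \<Omega> "partial_x u" p] Lp_norm_eq_0[of \<Omega> "partial_y u" p] by auto
  next
    case True
    note ae = AE_vertical_derivative[OF dom u]
    let ?X = "LINT z:\<Omega>|lebesgue. \<bar>partial_x u z\<bar> powr p"
    let ?Y = "LINT z:\<Omega>|lebesgue. \<bar>partial_y u z\<bar> powr p"
    have nn: "0 \<le> ?X" "0 \<le> ?Y"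
      unfolding set_lebesgue_integral_def by (auto intro!: integral_nonneg_AE)
    have "ennreal ?X = (\<integral>\<^sup>+ z. ennreal (\<bar>partial_x u z\<bar> powr p) * indicator \<Omega> z \<partial>lborel)"
      by (rule nn_integral_set_lebesgue) (use True in auto)
    also have "\<dots> \<le> ennreal (S powr p) *
        (\<integral>\<^sup>+ z. ennreal (\<bar>vertical_derivative (zero_extension \<Omega> u) z\<bar> powr p) * indicator \<Omega> z \<partial>lborel)"
      by (rule nn_integral_partial_x_le[OF p pc dom u PQ strip cone k \<mu> S_def ae])
    also have "(\<integral>\<^sup>+ z. ennreal (\<bar>vertical_derivative (zero_extension \<Omega> u) z\<bar> powr p) * indicator \<Omega> z \<partial>lborel)
        = ennreal ?Y"
      using ae by (intro nn_integral_set_lebesgue[symmetric]) (use True in \<open>auto elim: eventually_mono\<close>)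
    finally have "?X \<le> S powr p * ?Y"
      using nn by (simp flip: ennreal_mult)
    then have "?X powr (1 / p) \<le> (S powr p * ?Y) powr (1 / p)"
      using nn p by (intro powr_mono2) auto
    also have "\<dots> = S * ?Y powr (1 / p)"
      using nn S0 p by (simp add: powr_mult powr_powr)
    finally show ?thesis
      using S0 by (cases "?Y powr (1 / p) = 0") (auto simp: Lp_norm_def divide_le_eq)
  qed
  then show ?thesis
    unfolding K_const_def S_def[symmetric] by (intro SUP_least) auto
qed


section \<open>Normalization of the domain\<close>

lemma normalized_domain_eq_image:
  assumes w: "0 < x_width \<Omega>"
  shows "normalized_domain \<Omega> = (\<lambda>z. (2 / x_width \<Omega> * (fst z - fst (left_point \<Omega>)),
      snd z - snd (left_point \<Omega>) - y_shift \<Omega> / x_width \<Omega> * (fst z - fst (left_point \<Omega>)))) ` \<Omega>"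
    (is "_ = ?S ` \<Omega>")
proof
  show "normalized_domain \<Omega> \<subseteq> ?S ` \<Omega>"
  proof
    fix z' assume z': "z' \<in> normalized_domain \<Omega>"
    obtain x y where xy: "z' = (x, y)" by fastforce
    let ?z = "(fst (left_point \<Omega>) + x_width \<Omega> / 2 * x, snd (left_point \<Omega>) + y_shift \<Omega> / 2 * x + y)"
    have "?z \<in> \<Omega>" using z' by (simp add: normalized_domain_def xy)
    moreover have "z' = ?S ?z" using w by (simp add: xy)
    ultimately show "z' \<in> ?S ` \<Omega>" by (rule rev_image_eqI)
  qed
  show "?S ` \<Omega> \<subseteq> normalized_domain \<Omega>"
  proof
    fix z' assume "z' \<in> ?S ` \<Omega>"
    then obtain z where "z \<in> \<Omega>" "z' = ?S z" by blast
    moreover have "x_width \<Omega> / 2 * (2 / x_width \<Omega> * r) = r"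
      "y_shift \<Omega> / 2 * (2 / x_width \<Omega> * r) = y_shift \<Omega> / x_width \<Omega> * r" for r
      using w by simp_all
    ultimately show "z' \<in> normalized_domain \<Omega>"
      unfolding normalized_domain_def by (simp only: mem_Collect_eq prod.case) simp
  qed
qed

lemma convex_normalized_domain:
  assumes "convex \<Omega>"
  shows "convex (normalized_domain \<Omega>)"
proof (rule convexI)
  fix a b :: "real \<times> real" and s t :: real
  assume ab: "a \<in> normalized_domain \<Omega>" "b \<in> normalized_domain \<Omega>" and st: "0 \<le> s" "0 \<le> t" "s + t = 1"
  define T where "T z = (fst (left_point \<Omega>) + x_width \<Omega> / 2 * fst z,
    snd (left_point \<Omega>) + y_shift \<Omega> / 2 * fst z + snd z)" for z :: "real \<times> real"
  have iff: "z \<in> normalized_domain \<Omega> \<longleftrightarrow> T z \<in> \<Omega>" for z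
    by (cases z) (simp add: normalized_domain_def T_def)
  have q: "s * q + t * q = q" for q :: real using st(3) by (metis distrib_right mult_1)
  then have "s *\<^sub>R T a + t *\<^sub>R T b = T (s *\<^sub>R a + t *\<^sub>R b)"
    by (simp add: T_def algebra_simps) (simp add: q)
  moreover have "s *\<^sub>R T a + t *\<^sub>R T b \<in> \<Omega>"
    using ab st assms by (intro convexD) (auto simp: iff)
  ultimately show "s *\<^sub>R a + t *\<^sub>R b \<in> normalized_domain \<Omega>" by (simp add: iff)
qed

theorem theorem7:
  fixes p C :: real and \<Omega> :: "(real \<times> real) set"
  assumes "1 < p"
    and "poincare_constant p C"
    and "convex_compact_domain \<Omega>"
    and "both_vertical_support_lines_angular \<Omega>"
  shows "(left_point \<Omega> = (0, 0) \<and> right_point \<Omega> = (2, 0) \<longrightarrow>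
            K_const p \<Omega> \<le> ereal (M_bound p C \<Omega>)) \<and>
         (left_point (normalized_domain \<Omega>) = (0, 0) \<and>
          right_point (normalized_domain \<Omega>) = (2, 0) \<and>
          K_const p \<Omega> \<le> ereal (2 / x_width \<Omega> * M_bound p C (normalized_domain \<Omega>)
                                + \<bar>y_shift \<Omega>\<bar> / x_width \<Omega>))"
proof -
  obtain P Q \<kappa> where PQ: "P \<in> \<Omega>" "Q \<in> \<Omega>" "fst P < fst Q"
    and L: "left_point \<Omega> = P" and R: "right_point \<Omega> = Q" and W: "x_width \<Omega> = fst Q - fst P"
    and \<kappa>: "0 \<le> \<kappa>" and strip: "\<And>z. z \<in> \<Omega> \<Longrightarrow> fst P \<le> fst z \<and> fst z \<le> fst Q"
    and coneP: "\<And>z. z \<in> \<Omega> \<Longrightarrow> \<bar>snd z - snd P\<bar> \<le> \<kappa> * (fst z - fst P)"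
    and coneQ: "\<And>z. z \<in> \<Omega> \<Longrightarrow> \<bar>snd z - snd Q\<bar> \<le> \<kappa> * (fst Q - fst z)"
    by (rule angular_domain_extreme_points[OF assms(3,4)]) blast
  define w c k where "w = fst Q - fst P" and "c = snd Q - snd P" and "k = c / w"
  have w: "0 < w" "x_width \<Omega> = w" and c: "y_shift \<Omega> = c" "c = k * w"
    using PQ(3) by (auto simp: w_def W c_def y_shift_def L R k_def)
  let ?N = "normalized_domain \<Omega>"
  define S where "S z = (2 / w * (fst z - fst P), snd z - snd P - k * (fst z - fst P))" for z :: "real \<times> real"
  have N: "?N = S ` \<Omega>"
    using normalized_domain_eq_image[of \<Omega>] w(1) unfolding w(2) c(1) L S_def[abs_def] k_def by simp
  have cp: "compact ?N"
    unfolding N S_def using assms(3)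
    by (intro compact_continuous_image continuous_intros) (auto simp: convex_compact_domain_def)
  have cv: "convex ?N"
    using assms(3) by (intro convex_normalized_domain) (simp add: convex_compact_domain_def)
  have "S P = (0, 0)" "S Q = (2, 0)" using w(1) by (simp_all add: S_def k_def flip: w_def c_def)
  then have ends: "(0, 0) \<in> ?N" "(2, 0) \<in> ?N" using PQ unfolding N by force+
  have flip: "2 - 2 / w * (fst z - fst P) = 2 / w * (fst Q - fst z)" for z
  proof -
    have "2 / w * (fst z - fst P) + 2 / w * (fst Q - fst z) = 2 / w * w"
      unfolding distrib_left[symmetric] by (simp add: w_def)
    then show ?thesis using w(1) by simp
  qed
  have sub: "x \<in> {0..2}" if xy: "(x, y) \<in> ?N" for x y
  proof -
    obtain z where z: "z \<in> \<Omega>" "x = 2 / w * (fst z - fst P)" using xy unfolding N S_def by blast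
    have "0 \<le> 2 / w * (fst z - fst P)" "0 \<le> 2 / w * (fst Q - fst z)"
      using strip[OF z(1)] w(1) by (intro mult_nonneg_nonneg; simp)+
    then show ?thesis using flip[of z] z(2) by auto
  qed
  \<comment> \<open>The normalized domain lies in some double cone; its slopes are therefore finite.\<close>
  define \<kappa>' where "\<kappa>' = (\<kappa> + \<bar>k\<bar>) * w / 2"
  have \<kappa>'_scale: "\<kappa>' * (2 / w * r) = (\<kappa> + \<bar>k\<bar>) * r" for r
    using w(1) by (simp add: \<kappa>'_def)
  have cone: "\<bar>y\<bar> \<le> \<kappa>' * x" "\<bar>y\<bar> \<le> \<kappa>' * (2 - x)" if xy: "(x, y) \<in> ?N" for x y
  proof -
    obtain z where z: "z \<in> \<Omega>" "(x, y) = S z" using xy unfolding N by blast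
    then have x: "x = 2 / w * (fst z - fst P)" and y: "y = snd z - snd P - k * (fst z - fst P)"
      by (auto simp: S_def)
    have y': "y = snd z - snd Q + k * (fst Q - fst z)"
      using c(2) unfolding y c_def w_def by (simp add: algebra_simps)
    have "\<bar>y\<bar> \<le> \<bar>snd z - snd P\<bar> + \<bar>k\<bar> * (fst z - fst P)"
      using strip[OF z(1)] abs_triangle_ineq4[of "snd z - snd P" "k * (fst z - fst P)"]
      by (simp add: y abs_mult)
    also have "\<dots> \<le> (\<kappa> + \<bar>k\<bar>) * (fst z - fst P)"
      using coneP[OF z(1)] by (simp add: distrib_right)
    finally show "\<bar>y\<bar> \<le> \<kappa>' * x" unfolding x \<kappa>'_scale .
    have "\<bar>y\<bar> \<le> \<bar>snd z - snd Q\<bar> + \<bar>k\<bar> * (fst Q - fst z)"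
      using strip[OF z(1)] abs_triangle_ineq[of "snd z - snd Q" "k * (fst Q - fst z)"]
      by (simp add: y' abs_mult)
    also have "\<dots> \<le> (\<kappa> + \<bar>k\<bar>) * (fst Q - fst z)"
      using coneQ[OF z(1)] by (simp add: distrib_right)
    finally show "\<bar>y\<bar> \<le> \<kappa>' * (2 - x)" unfolding x flip \<kappa>'_scale .
  qed
  have left: "left_point ?N = (0, 0)"
    unfolding left_point_def
  proof (rule the_equality)
    fix z assume z: "z \<in> ?N \<and> (\<forall>w\<in>?N. fst z \<le> fst w)"
    obtain x y where xy: "z = (x, y)" by fastforce
    then have "x = 0" using z sub[of x y] ends by force
    then show "z = (0, 0)" using z cone(1)[of x y] by (simp add: xy)
  qed (use ends sub in force)
  have right: "right_point ?N = (2, 0)"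
    unfolding right_point_def
  proof (rule the_equality)
    fix z assume z: "z \<in> ?N \<and> (\<forall>w\<in>?N. fst w \<le> fst z)"
    obtain x y where xy: "z = (x, y)" by fastforce
    then have "x = 2" using z sub[of x y] ends by force
    then show "z = (2, 0)" using z cone(2)[of x y] by (simp add: xy)
  qed (use ends sub in force)
  define m where "m = max_slope ?N"
  have cone': "\<bar>snd z - snd P - k * (fst z - fst P)\<bar> \<le> (2 / w * m) * min (fst z - fst P) (fst Q - fst z)"
    if "z \<in> \<Omega>" for z
  proof -
    have "S z \<in> ?N" using that by (simp add: N)
    note b = abs_snd_le_max_slope[OF cp cv ends sub cone this[unfolded S_def], folded m_def]
    have "\<bar>snd z - snd P - k * (fst z - fst P)\<bar> \<le> (2 / w * m) * (fst z - fst P)"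
      "\<bar>snd z - snd P - k * (fst z - fst P)\<bar> \<le> (2 / w * m) * (fst Q - fst z)"
      using b unfolding flip by (simp_all add: mult_ac)
    then show ?thesis by (simp add: min_def)
  qed
  have "K_const p \<Omega> \<le> ereal (2 / w * m * (2 * C powr (1 / p) + 1) + \<bar>k\<bar>)"
    by (rule K_const_le[OF assms(1-3) PQ strip cone']) (auto simp: k_def c_def w_def)
  also have "2 / w * m * (2 * C powr (1 / p) + 1) + \<bar>k\<bar>
      = 2 / x_width \<Omega> * M_bound p C ?N + \<bar>y_shift \<Omega>\<bar> / x_width \<Omega>"
    using w by (simp add: M_bound_def m_def c(1) k_def abs_divide)
  finally have K: "K_const p \<Omega> \<le> ereal (2 / x_width \<Omega> * M_bound p C ?N + \<bar>y_shift \<Omega>\<bar> / x_width \<Omega>)" .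
  have "K_const p \<Omega> \<le> ereal (M_bound p C \<Omega>)" if "left_point \<Omega> = (0, 0)" "right_point \<Omega> = (2, 0)"
  proof -
    have "x_width \<Omega> = 2" "y_shift \<Omega> = 0"
      using that by (simp_all add: W y_shift_def flip: L R)
    then show ?thesis using K that by (simp add: normalized_domain_def)
  qed
  with K left right show ?thesis by blast
qed

end
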